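(* Let $\tilde{\Delta}$ be the partial differential operator $$\tilde{\Delta}=-4(1-|z|^2)\left[(1-|z|^2)\frac{\partial^2}{\partial z\,\partial\overline{z}}-2\overline{z}\frac{\partial}{\partial\overline{z}}\right]$$ acting on the Hilbert space $L^2(\mathbb{D},d\lambda(z))$ with the dense domain $$D(\tilde{\Delta})=\left\{F\in L^2(\mathbb{D},d\lambda(z)):\ \tilde{\Delta}F\in L^2(\mathbb{D},d\lambda(z))\ \text{and}\ \frac{\partial F}{\partial z}\in L^2(\mathbb{D},d\lambda(z))\right\}.$$ Then the Dirichlet space $\mathcal{D}$ is the null space of $\tilde{\Delta}$: $$\mathcal{D}=\{F\in D(\tilde{\Delta}):\ \tilde{\Delta}F=0\}.$$
   Context: $\mathbb{D}$ is the open unit disk in $\mathbb{C}$, $d\lambda$ is Lebesgue area measure, and $\partial/\partial z$, $\partial/\partial\overline{z}$ are the Wirtinger derivatives, with derivatives of $L^2$ functions taken in the sense of distributions. The Dirichlet space $\mathcal{D}$ is the space of holomorphic functions $f$ on $\mathbb{D}$ with $\frac1\pi\int_{\mathbb{D}}|f'(z)|^2\,d\lambda(z)<\infty$. Elements of $L^2$ are identified up to equality almost everywhere. *)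

theory Defs
  imports "HOL-Complex_Analysis.Complex_Analysis"
begin

abbreviation disk :: "complex set" where
  "disk \<equiv> ball 0 1"

text \<open>Classical derivatives; \<complex> is regarded as a real vector space with basis 1, \<i>.\<close>

definition partial_x :: "(complex \<Rightarrow> complex) \<Rightarrow> complex \<Rightarrow> complex" where
  "partial_x f z = frechet_derivative f (at z) 1"

definition partial_y :: "(complex \<Rightarrow> complex) \<Rightarrow> complex \<Rightarrow> complex" where
  "partial_y f z = frechet_derivative f (at z) \<i>"

definition wirtinger :: "(complex \<Rightarrow> complex) \<Rightarrow> complex \<Rightarrow> complex" where
  "wirtinger f z = (partial_x f z - \<i> * partial_y f z) / 2"

definition wirtinger_bar :: "(complex \<Rightarrow> complex) \<Rightarrow> complex \<Rightarrow> complex" where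
  "wirtinger_bar f z = (partial_x f z + \<i> * partial_y f z) / 2"

fun C_k :: "nat \<Rightarrow> (complex \<Rightarrow> complex) \<Rightarrow> bool" where
  "C_k 0 f \<longleftrightarrow> continuous_on UNIV f"
| "C_k (Suc k) f \<longleftrightarrow> f differentiable_on UNIV \<and> C_k k (partial_x f) \<and> C_k k (partial_y f)"

definition test_functions :: "(complex \<Rightarrow> complex) set" where
  "test_functions = {\<phi>. (\<forall>k. C_k k \<phi>) \<and>
     compact (closure {z. \<phi> z \<noteq> 0}) \<and> closure {z. \<phi> z \<noteq> 0} \<subseteq> disk}"

text \<open>
  Distributions on the disk are represented by functionals of which only the values on
  \<^const>\<open>test_functions\<close> matter, whence the relation \<open>dist_eq\<close>. Linearity and continuity are
  not recorded: the functionals below all arise from square-integrable functions by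
  differentiation and by multiplication with smooth functions.
\<close>

type_synonym distr = "(complex \<Rightarrow> complex) \<Rightarrow> complex"

definition dist_eq :: "distr \<Rightarrow> distr \<Rightarrow> bool" where
  "dist_eq S T \<longleftrightarrow> (\<forall>\<phi>\<in>test_functions. S \<phi> = T \<phi>)"

definition dist_of :: "(complex \<Rightarrow> complex) \<Rightarrow> distr" where
  "dist_of F \<phi> = (LINT z|lebesgue_on disk. F z * \<phi> z)"

definition dist_mult :: "(complex \<Rightarrow> complex) \<Rightarrow> distr \<Rightarrow> distr" where
  "dist_mult a T \<phi> = T (\<lambda>z. a z * \<phi> z)"

definition dist_diff :: "distr \<Rightarrow> distr \<Rightarrow> distr" where
  "dist_diff S T \<phi> = S \<phi> - T \<phi>"

definition dist_dz :: "distr \<Rightarrow> distr" where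
  "dist_dz T \<phi> = - T (wirtinger \<phi>)"

definition dist_dzbar :: "distr \<Rightarrow> distr" where
  "dist_dzbar T \<phi> = - T (wirtinger_bar \<phi>)"

definition Delta_tilde :: "distr \<Rightarrow> distr" where
  "Delta_tilde T =
     dist_mult (\<lambda>z. - 4 * (1 - complex_of_real ((cmod z)\<^sup>2)))
       (dist_diff
         (dist_mult (\<lambda>z. 1 - complex_of_real ((cmod z)\<^sup>2)) (dist_dz (dist_dzbar T)))
         (dist_mult (\<lambda>z. 2 * cnj z) (dist_dzbar T)))"

text \<open>
  Members of \<open>L2_disk\<close> are representatives, total functions whose values off the disk are
  irrelevant; the elements of the Hilbert space are the classes \<open>L2_class F\<close>.
\<close>

definition L2_disk :: "(complex \<Rightarrow> complex) set" where
  "L2_disk = {F \<in> borel_measurable (lebesgue_on disk).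
     integrable (lebesgue_on disk) (\<lambda>z. (cmod (F z))\<^sup>2)}"

definition L2_norm :: "(complex \<Rightarrow> complex) \<Rightarrow> real" where
  "L2_norm F = sqrt (LINT z|lebesgue_on disk. (cmod (F z))\<^sup>2)"

definition L2_class :: "(complex \<Rightarrow> complex) \<Rightarrow> (complex \<Rightarrow> complex) set" where
  "L2_class F = {G \<in> L2_disk. F \<in> L2_disk \<and> (AE z in lebesgue_on disk. F z = G z)}"

definition dist_in_L2 :: "distr \<Rightarrow> bool" where
  "dist_in_L2 T \<longleftrightarrow> (\<exists>G\<in>L2_disk. dist_eq T (dist_of G))"

definition Delta_domain :: "(complex \<Rightarrow> complex) set" where
  "Delta_domain = {F \<in> L2_disk.
     dist_in_L2 (Delta_tilde (dist_of F)) \<and> dist_in_L2 (dist_dz (dist_of F))}"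

definition dirichlet_space :: "(complex \<Rightarrow> complex) set" where
  "dirichlet_space = {f. f holomorphic_on disk \<and>
     ennreal (1 / pi) * (\<integral>\<^sup>+ z. ennreal ((cmod (deriv f z))\<^sup>2) \<partial>lebesgue_on disk) < \<infinity>}"

end

theory Submission
  imports Defs
begin

text \<open>
  Write \<open>s = |z|\<^sup>2\<close>. In divergence form the operator maps \<open>F\<close> to \<open>-4 \<partial>((1 - s)\<^sup>2 \<partial>' F)\<close>, where
  \<open>\<partial>'\<close> is the derivative in \<open>cnj z\<close>, so holomorphic functions are in its kernel. Conversely, the factor \<open>(1 - s)\<^sup>2\<close>
  absorbs two derivatives of a cutoff at the boundary; hence a distributional null solution \<open>F\<close> in
  \<open>L\<^sup>2\<close> annihilates the transposed operator applied to every polynomial in \<open>z\<close> and \<open>cnj z\<close>, not only to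
  test functions. For monomials this is a two-term recursion for the moments of \<open>(1 - s) F\<close>, which leaves
  only the moments against \<open>cnj z ^ d\<close> free. A power series \<open>f\<close> realises any choice of these, and since
  polynomials are dense in \<open>L\<^sup>2\<close>, \<open>F = f\<close> almost everywhere; no elliptic regularity is needed. The
  condition on the \<open>z\<close>-derivative of \<open>F\<close> then says that \<open>f'\<close> is in \<open>L\<^sup>2\<close>.
\<close>

section \<open>Wirtinger derivatives and smooth functions\<close>

text \<open>Every square-integrable holomorphic function solves the equation, so without the
  condition on the z-derivative the null space would be the Bergman space. Two integrability
  questions shape the proof. First, the power series \<open>f\<close> built from the moments of
  \<open>F\<close> is not known to be square-integrable: its coefficients grow at most
  quadratically, which bounds it only by a multiple of (1 - |z|)^-3. So \<open>F\<close> and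
  \<open>f\<close> are compared after multiplication by (1 - s)^4: one factor is the weight that the
  moments already carry, and three make \<open>f\<close> bounded. As 1 - s has no zero in the disk,
  nothing is lost. Second, a function in the Dirichlet space comes only with a square-integrable
  derivative and must be shown to lie in L^2 itself. This uses its increment along the radius from z
  / 2 to z, because z / 2 stays in a compact part of the disk. The weight in the moments is what
  makes the recursion two-term; the moments of \<open>F\<close> itself would satisfy a relation with
  three terms.\<close>

definition has_wirt :: "(complex \<Rightarrow> complex) \<Rightarrow> complex \<Rightarrow> complex \<Rightarrow> complex \<Rightarrow> bool" where
  "has_wirt f a b z \<longleftrightarrow> (f has_derivative (\<lambda>h. a * h + b * cnj h)) (at z)"

lemma partial_eqI:
  assumes "(f has_derivative D) (at z)"
  shows "partial_x f z = D 1" "partial_y f z = D \<i>"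
  using frechet_derivative_at[OF assms] by (simp_all add: partial_x_def partial_y_def)

lemma has_wirt_partial:
  assumes "has_wirt f a b z"
  shows "partial_x f z = a + b" "partial_y f z = \<i> * (a - b)"
  using partial_eqI[OF assms[unfolded has_wirt_def]] by (simp_all add: algebra_simps)

lemma has_wirtD:
  assumes "has_wirt f a b z"
  shows "wirtinger f z = a" "wirtinger_bar f z = b" "f differentiable at z"
proof -
  show "wirtinger f z = a" "wirtinger_bar f z = b"
    by (simp_all add: wirtinger_def wirtinger_bar_def has_wirt_partial[OF assms]
          flip: mult.assoc)
  show "f differentiable at z"
    using assms unfolding has_wirt_def differentiable_def by blast
qed

text \<open>A real-linear map of the plane is determined by its values at 1 and \<i>. Writing the
  coordinates of h as (h + cnj h) / 2 and - \<i> (h - cnj h) / 2 turns these values into the two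
  Wirtinger coefficients, so that the later calculus can be done with
  \<open>has_wirt\<close>.\<close>

lemma differentiable_has_wirt:
  assumes "f differentiable at z"
  shows "has_wirt f (wirtinger f z) (wirtinger_bar f z) z"
proof -
  define D where "D = frechet_derivative f (at z)"
  have D: "(f has_derivative D) (at z)"
    using assms by (simp add: D_def frechet_derivative_works)
  then interpret bounded_linear D by (rule has_derivative_bounded_linear)
  have "D h = wirtinger f z * h + wirtinger_bar f z * cnj h" for h
  proof -
    have "D h = D (Re h *\<^sub>R 1 + Im h *\<^sub>R \<i>)"
      by (rule arg_cong[where f=D]) (simp add: complex_eq_iff)
    also have "\<dots> = of_real (Re h) * D 1 + of_real (Im h) * D \<i>"
      unfolding add scaleR by (simp add: scaleR_conv_of_real)
    also have "of_real (Re h) = (h + cnj h) / 2"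
      by (simp add: complex_eq_iff)
    also have "of_real (Im h) = - \<i> * (h - cnj h) / 2"
      by (simp add: complex_eq_iff)
    finally show ?thesis
      by (simp add: wirtinger_def wirtinger_bar_def partial_eqI[OF D] field_simps)
  qed
  then have "D = (\<lambda>h. wirtinger f z * h + wirtinger_bar f z * cnj h)" ..
  then show ?thesis
    using D by (simp add: has_wirt_def)
qed

lemma has_wirt_const: "has_wirt (\<lambda>_. c) 0 0 z"
  by (simp add: has_wirt_def)

lemma has_wirt_ident: "has_wirt (\<lambda>z. z) 1 0 z"
  by (simp add: has_wirt_def)

lemma has_wirt_cnj: "has_wirt cnj 0 1 z"
  by (simp add: has_wirt_def bounded_linear_imp_has_derivative bounded_linear_cnj)

lemma has_wirt_add:
  assumes "has_wirt f a b z" "has_wirt g c d z"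
  shows "has_wirt (\<lambda>z. f z + g z) (a + c) (b + d) z"
  using has_derivative_add[OF assms[unfolded has_wirt_def]]
  by (simp add: has_wirt_def algebra_simps)

lemma has_wirt_mult:
  assumes "has_wirt f a b z" "has_wirt g c d z"
  shows "has_wirt (\<lambda>z. f z * g z) (a * g z + f z * c) (b * g z + f z * d) z"
  using has_derivative_mult[OF assms[unfolded has_wirt_def]]
  by (simp add: has_wirt_def algebra_simps)

lemma has_wirt_cmult:
  assumes "has_wirt f a b z"
  shows "has_wirt (\<lambda>z. c * f z) (c * a) (c * b) z"
  using has_wirt_mult[OF has_wirt_const assms, of c] by simp

lemma has_wirt_mon:
  "has_wirt (\<lambda>z. z ^ m * cnj z ^ n)
     (of_nat m * z ^ (m - 1) * cnj z ^ n) (of_nat n * z ^ m * cnj z ^ (n - 1)) z"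
  unfolding has_wirt_def
  by (rule derivative_eq_intros refl)+ (simp add: algebra_simps)

lemma has_wirt_holomorphic:
  assumes "f holomorphic_on S" "open S" "z \<in> S"
  shows "has_wirt f (deriv f z) 0 z"
  using holomorphic_derivI[OF assms] by (simp add: has_wirt_def has_field_derivative_def)

lemma has_wirt_unique:
  assumes "has_wirt f a b z" "has_wirt f c d z"
  shows "a = c" "b = d"
  using has_wirtD[OF assms(1)] has_wirtD[OF assms(2)] by auto

section \<open>Closure properties of smooth functions\<close>

lemma C_k_Suc_imp: "C_k (Suc k) f \<Longrightarrow> C_k k f"
proof (induction k arbitrary: f)
  case (Suc k)
  show ?case
    using Suc.prems Suc.IH[of "partial_x f"] Suc.IH[of "partial_y f"] by simp
qed (simp add: differentiable_imp_continuous_on)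

lemma C_k_continuous: "C_k k f \<Longrightarrow> continuous_on UNIV f"
  by (cases k) (auto simp: differentiable_imp_continuous_on)

lemma C_k_differentiable: "C_k (Suc k) f \<Longrightarrow> f differentiable at z"
  by (simp add: differentiable_on_def)

lemma C_k_const: "C_k k (\<lambda>_. c)"
proof (induction k arbitrary: c)
  case (Suc k)
  have "partial_x (\<lambda>_::complex. c) = (\<lambda>_. 0)" "partial_y (\<lambda>_::complex. c) = (\<lambda>_. 0)"
    using has_wirt_partial[OF has_wirt_const] by auto
  then show ?case
    using Suc[of 0] by simp
qed simp

lemma C_k_add: "C_k k f \<Longrightarrow> C_k k g \<Longrightarrow> C_k k (\<lambda>z. f z + g z)"
proof (induction k arbitrary: f g)
  case (Suc k)
  have w: "has_wirt f (wirtinger f z) (wirtinger_bar f z) z"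
          "has_wirt g (wirtinger g z) (wirtinger_bar g z) z" for z
    using Suc.prems by (auto intro!: differentiable_has_wirt C_k_differentiable)
  have "partial_x (\<lambda>z. f z + g z) = (\<lambda>z. partial_x f z + partial_x g z)"
       "partial_y (\<lambda>z. f z + g z) = (\<lambda>z. partial_y f z + partial_y g z)"
    by (simp_all add: fun_eq_iff has_wirt_partial[OF has_wirt_add[OF w]]
          has_wirt_partial[OF w(1)] has_wirt_partial[OF w(2)] algebra_simps)
  then show ?case
    using Suc by (auto intro: differentiable_on_add)
qed (simp add: continuous_on_add)

lemma C_k_mult: "C_k k f \<Longrightarrow> C_k k g \<Longrightarrow> C_k k (\<lambda>z. f z * g z)"
proof (induction k arbitrary: f g)
  case (Suc k)
  have w: "has_wirt f (wirtinger f z) (wirtinger_bar f z) z"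
          "has_wirt g (wirtinger g z) (wirtinger_bar g z) z" for z
    using Suc.prems by (auto intro!: differentiable_has_wirt C_k_differentiable)
  have "partial_x (\<lambda>z. f z * g z) = (\<lambda>z. partial_x f z * g z + f z * partial_x g z)"
       "partial_y (\<lambda>z. f z * g z) = (\<lambda>z. partial_y f z * g z + f z * partial_y g z)"
    by (simp_all add: fun_eq_iff has_wirt_partial[OF has_wirt_mult[OF w]]
          has_wirt_partial[OF w(1)] has_wirt_partial[OF w(2)] algebra_simps)
  then show ?case
    using Suc.prems Suc.IH C_k_Suc_imp[OF Suc.prems(1)] C_k_Suc_imp[OF Suc.prems(2)]
    by (simp add: C_k_add differentiable_on_mult)
qed (simp add: continuous_on_mult)

text \<open>The partial derivatives are linear combinations of the Wirtinger coefficients, so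
  smoothness of an explicit function can be proved by induction on the order from these coefficients
  alone.\<close>

lemma C_k_SucI:
  assumes w: "\<And>z. has_wirt f (a z) (b z) z" and "C_k k a" "C_k k b"
  shows "C_k (Suc k) f"
proof -
  have "partial_x f = (\<lambda>z. a z + b z)" "partial_y f = (\<lambda>z. \<i> * (a z + (-1) * b z))"
    using has_wirt_partial[OF w] by auto
  moreover have "C_k k (\<lambda>z. a z + b z)" "C_k k (\<lambda>z. \<i> * (a z + (-1) * b z))"
    by (intro C_k_add C_k_mult C_k_const assms)+
  ultimately show ?thesis
    using has_wirtD(3)[OF w] by (simp add: differentiable_on_def differentiable_at_withinI)
qed

lemma C_k_wirtinger:
  assumes "C_k (Suc k) f"
  shows "C_k k (wirtinger f)" "C_k k (wirtinger_bar f)"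
proof -
  have p: "C_k k (partial_x f)" "C_k k (partial_y f)"
    using assms by simp_all
  have c: "C_k k (\<lambda>z. (1/2) * (partial_x f z + c * partial_y f z))" for c
    by (rule C_k_mult[OF C_k_const C_k_add[OF p(1) C_k_mult[OF C_k_const p(2)]]])
  show "C_k k (wirtinger f)"
    using c[of "- \<i>"] by (simp add: wirtinger_def[abs_def])
  show "C_k k (wirtinger_bar f)"
    using c[of "\<i>"] by (simp add: wirtinger_bar_def[abs_def])
qed

lemma C_k_ident: "C_k k (\<lambda>z. z)"
proof (cases k)
  case (Suc n)
  show ?thesis unfolding Suc by (rule C_k_SucI[OF has_wirt_ident C_k_const C_k_const])
qed simp

lemma C_k_cnj: "C_k k cnj"
proof (cases k)
  case (Suc n)
  show ?thesis unfolding Suc by (rule C_k_SucI[OF has_wirt_cnj C_k_const C_k_const])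
qed (simp add: continuous_on_cnj[OF continuous_on_id, unfolded id_def])

lemma C_k_power: "C_k k f \<Longrightarrow> C_k k (\<lambda>z. f z ^ n)"
  by (induction n) (auto intro: C_k_const C_k_mult)

text \<open>The derivatives of \<open>exp (- 1 / t)\<close> all have the form \<open>flat_exp p\<close>.\<close>

definition flat_exp :: "real poly \<Rightarrow> real \<Rightarrow> real" where
  "flat_exp p t = (if t > 0 then poly p (1 / t) * exp (- (1 / t)) else 0)"

text \<open>For x = 1 / t, with dx/dt = - x^2, the derivative of p(x) exp (- x) in t is x^2 (p(x) -
  p'(x)) exp (- x).\<close>

definition flat_deriv :: "real poly \<Rightarrow> real poly" where
  "flat_deriv p = [:0, 0, 1:] * (p - pderiv p)"

lemma poly_times_exp_neg_tendsto_0: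
  "((\<lambda>x::real. poly p x * exp (- x)) \<longlongrightarrow> 0) at_top"
proof -
  have "((\<lambda>x::real. (\<Sum>i\<le>degree p. coeff p i * (x ^ i / exp x))) \<longlongrightarrow>
           (\<Sum>i\<le>degree p. coeff p i * 0)) at_top"
    by (intro tendsto_intros tendsto_power_div_exp_0)
  then show ?thesis
    by (simp add: poly_altdef sum_distrib_right exp_minus divide_inverse mult.assoc)
qed

lemma poly_times_exp_neg_bounded:
  obtains B where "\<And>x::real. x \<ge> 0 \<Longrightarrow> \<bar>poly p x * exp (- x)\<bar> \<le> B"
proof -
  have "\<forall>\<^sub>F x::real in at_top. dist (poly p x * exp (- x)) 0 < 1"
    by (rule tendstoD[OF poly_times_exp_neg_tendsto_0]) simp
  then obtain N where N: "\<And>x::real. x \<ge> N \<Longrightarrow> \<bar>poly p x * exp (- x)\<bar> < 1"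
    by (auto simp: eventually_at_top_linorder)
  have "compact ((\<lambda>x::real. poly p x * exp (- x)) ` {0..N})"
    by (intro compact_continuous_image continuous_intros) auto
  then obtain C where C: "\<And>x::real. x \<in> {0..N} \<Longrightarrow> \<bar>poly p x * exp (- x)\<bar> \<le> C"
    using compact_imp_bounded by (force simp: bounded_iff)
  show ?thesis
  proof
    fix x :: real assume "x \<ge> 0"
    then show "\<bar>poly p x * exp (- x)\<bar> \<le> max 1 C"
      using N[of x] C[of x] by (cases "x \<ge> N") (auto simp: max_def)
  qed
qed

lemma flat_exp_tendsto_0: "((\<lambda>t. flat_exp p t) \<longlongrightarrow> 0) (at_right 0)"
proof -
  have "((\<lambda>t::real. poly p (inverse t) * exp (- inverse t)) \<longlongrightarrow> 0) (at_right 0)"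
    by (rule filterlim_compose[OF poly_times_exp_neg_tendsto_0 filterlim_inverse_at_top_right])
  then show ?thesis
    by (rule Lim_transform_eventually)
       (auto simp: flat_exp_def divide_inverse intro!: eventually_at_rightI[of 0 1])
qed

lemma flat_exp_has_derivative:
  "(flat_exp p has_real_derivative flat_exp (flat_deriv p) t) (at t)"
proof (cases t "0::real" rule: linorder_cases)
  case less
  have "(flat_exp p has_real_derivative 0) (at t)"
    by (rule has_field_derivative_transform_within_open[of "\<lambda>_. 0" _ _ "{..<0}"])
       (use less in \<open>auto simp: flat_exp_def\<close>)
  then show ?thesis using less by (simp add: flat_exp_def)
next
  case greater
  have i: "((\<lambda>t. 1 / t) has_real_derivative - ((1 / t)\<^sup>2)) (at t)"
    using greater by (auto intro!: derivative_eq_intros simp: power2_eq_square)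
  have "((\<lambda>t. poly p (1 / t) * exp (- (1 / t))) has_real_derivative
      poly (pderiv p) (1 / t) * - ((1 / t)\<^sup>2) * exp (- (1 / t)) +
      exp (- (1 / t)) * - (- ((1 / t)\<^sup>2)) * poly p (1 / t)) (at t)"
    by (rule DERIV_mult DERIV_chain2[OF poly_DERIV i] DERIV_chain2[OF DERIV_exp DERIV_minus[OF i]])+
  also have "poly (pderiv p) (1 / t) * - ((1 / t)\<^sup>2) * exp (- (1 / t)) +
      exp (- (1 / t)) * - (- ((1 / t)\<^sup>2)) * poly p (1 / t) = flat_exp (flat_deriv p) t"
    using greater by (simp add: flat_exp_def flat_deriv_def power2_eq_square ring_distribs)
  finally show ?thesis
    by (rule has_field_derivative_transform_within_open[of _ _ _ "{0<..}"])
       (use greater in \<open>auto simp: flat_exp_def\<close>)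
next
  case equal
  \<comment> \<open>Dividing by h is multiplying by 1 / h, so the right difference quotient at 0 is
    again a flat function, with the polynomial X p.\<close>
  have "((\<lambda>h. (flat_exp p h - flat_exp p 0) / (h - 0)) \<longlongrightarrow> 0) (at_right 0)"
    using flat_exp_tendsto_0[of "pCons 0 p"]
    by (rule Lim_transform_eventually)
       (auto simp: flat_exp_def intro!: eventually_at_rightI[of 0 1])
  moreover have "((\<lambda>h. (flat_exp p h - flat_exp p 0) / (h - 0)) \<longlongrightarrow> 0) (at_left 0)"
    by (rule Lim_transform_eventually[of "\<lambda>_. 0"])
       (auto simp: flat_exp_def intro!: eventually_at_leftI[of "-1"])
  ultimately show ?thesis
    using equal by (simp add: has_field_derivative_iff filterlim_at_split flat_exp_def)
qed

lemma has_wirt_real_chain: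
  assumes "(h has_real_derivative h') (at (r z))" "has_wirt (\<lambda>z. of_real (r z)) a b z"
  shows "has_wirt (\<lambda>z. of_real (h (r z))) (of_real h' * a) (of_real h' * b) z"
proof -
  have D: "((\<lambda>z. complex_of_real (r z)) has_derivative (\<lambda>u. a * u + b * cnj u)) (at z)"
    using assms(2) by (simp add: has_wirt_def)
  have R: "(r has_derivative (\<lambda>u. Re (a * u + b * cnj u))) (at z)"
    using has_derivative_Re[OF D] by simp
  have "complex_of_real (Re (a * u + b * cnj u)) = a * u + b * cnj u" for u
  proof -
    have "((\<lambda>z. Im (complex_of_real (r z))) has_derivative (\<lambda>u. Im (a * u + b * cnj u))) (at z)"
      using has_derivative_Im[OF D] .
    then have "(\<lambda>u. Im (a * u + b * cnj u)) = (\<lambda>_. 0)"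
      using has_derivative_unique[OF _ has_derivative_const] by simp
    then show ?thesis by (metis complex_is_Real_iff of_real_Re)
  qed
  then have "(\<lambda>u. complex_of_real (h' * Re (a * u + b * cnj u))) =
      (\<lambda>u. complex_of_real h' * a * u + complex_of_real h' * b * cnj u)"
    by (simp only: of_real_mult distrib_left mult.assoc)
  moreover have "((\<lambda>z. h (r z)) has_derivative (\<lambda>u. h' * Re (a * u + b * cnj u))) (at z)"
    by (rule has_derivative_compose[OF R])
       (use assms(1) in \<open>simp add: has_field_derivative_def\<close>)
  then have "((\<lambda>z. complex_of_real (h (r z))) has_derivative
      (\<lambda>u. complex_of_real (h' * Re (a * u + b * cnj u)))) (at z)"
    by (rule has_derivative_of_real)
  ultimately show ?thesis
    unfolding has_wirt_def by (simp only:)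
qed

section \<open>Test functions and integration by parts\<close>

lemma has_wirt_locally_zero:
  assumes "open S" "z \<in> S" "\<And>w. w \<in> S \<Longrightarrow> f w = 0"
  shows "has_wirt f 0 0 z"
proof -
  have "((\<lambda>_. 0) has_derivative (\<lambda>h::complex. 0 * h + 0 * cnj h)) (at z)"
    by simp
  then show ?thesis
    unfolding has_wirt_def
    by (rule has_derivative_transform_within_open[of _ _ _ _ S]) (use assms in auto)
qed

lemma open_norm_greater: "open {z::complex. r < cmod z}"
  by (intro open_Collect_less continuous_intros)

lemma wirtinger_eq_0_outside:
  assumes "\<And>z. r < cmod z \<Longrightarrow> f z = 0" "r < cmod z"
  shows "wirtinger f z = 0" "wirtinger_bar f z = 0"
  using has_wirtD[OF has_wirt_locally_zero[OF open_norm_greater, of z r f]] assms by auto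

text \<open>The norm attains a maximum below 1 on a compact subset of the open disk; conversely, a
  closed ball contains the closure of the support. The form with a radius passes directly to
  products and derivatives.\<close>

lemma test_functions_iff:
  "\<phi> \<in> test_functions \<longleftrightarrow> (\<forall>k. C_k k \<phi>) \<and> (\<exists>r. 0 < r \<and> r < 1 \<and> (\<forall>z. r < cmod z \<longrightarrow> \<phi> z = 0))"
proof -
  have "compact (closure {z. \<phi> z \<noteq> 0}) \<and> closure {z. \<phi> z \<noteq> 0} \<subseteq> disk \<longleftrightarrow>
    (\<exists>r. 0 < r \<and> r < 1 \<and> (\<forall>z. r < cmod z \<longrightarrow> \<phi> z = 0))" (is "?L \<longleftrightarrow> ?R")
  proof
    assume L: ?L
    \<comment> \<open>Adding 0 keeps the set nonempty when the function vanishes identically. The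
      radius used below, midway between the maximum and 1, is positive even if the maximum is
      0.\<close>
    define K where "K = insert 0 (closure {z. \<phi> z \<noteq> 0})"
    have "compact K" "K \<noteq> {}" "K \<subseteq> disk"
      using L by (auto simp: K_def)
    then obtain x where x: "x \<in> K" "\<And>y. y \<in> K \<Longrightarrow> cmod y \<le> cmod x"
      using continuous_attains_sup[of K cmod] continuous_on_norm_id by blast
    have x1: "cmod x < 1"
      using x(1) \<open>K \<subseteq> disk\<close> by auto
    have "\<phi> z = 0" if "(cmod x + 1) / 2 < cmod z" for z
    proof (rule ccontr)
      assume "\<phi> z \<noteq> 0"
      then have "z \<in> K"
        using closure_subset[of "{z. \<phi> z \<noteq> 0}"] by (auto simp: K_def)
      then show False
        using x(2)[of z] x1 that by simp
    qed
    then show ?R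
      using x1 by (intro exI[of _ "(cmod x + 1) / 2"]) (auto simp: add_nonneg_pos)
  next
    assume ?R
    then obtain r where r: "0 < r" "r < 1" "\<And>z. r < cmod z \<Longrightarrow> \<phi> z = 0"
      by blast
    have "closure {z. \<phi> z \<noteq> 0} \<subseteq> cball 0 r"
      by (rule closure_minimal) (use r(3) in \<open>force simp: not_less\<close>)+
    moreover from this have "compact (closure {z. \<phi> z \<noteq> 0})"
      by (meson bounded_cball bounded_subset closed_closure compact_eq_bounded_closed)
    ultimately show ?L
      using r(2) by auto
  qed
  then show ?thesis
    by (auto simp: test_functions_def)
qed

lemma test_functionsE:
  assumes "\<phi> \<in> test_functions"
  obtains r where "0 < r" "r < 1" "\<And>z. r < cmod z \<Longrightarrow> \<phi> z = 0"
  using assms by (auto simp: test_functions_iff)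

lemma test_functions_C_k: "\<phi> \<in> test_functions \<Longrightarrow> C_k k \<phi>"
  by (simp add: test_functions_iff)

lemma test_functions_mult:
  assumes "\<And>k. C_k k a" "\<phi> \<in> test_functions"
  shows "(\<lambda>z. a z * \<phi> z) \<in> test_functions"
  using assms unfolding test_functions_iff by (fastforce intro: C_k_mult)

lemma test_functions_wirtinger:
  assumes "\<phi> \<in> test_functions"
  shows "wirtinger \<phi> \<in> test_functions" "wirtinger_bar \<phi> \<in> test_functions"
proof -
  have C: "C_k (Suc k) \<phi>" for k
    by (rule test_functions_C_k[OF assms])
  obtain r where r: "0 < r" "r < 1" "\<And>z. r < cmod z \<Longrightarrow> \<phi> z = 0"
    using test_functionsE[OF assms] by blast
  have "\<And>z. r < cmod z \<Longrightarrow> wirtinger \<phi> z = 0" "\<And>z. r < cmod z \<Longrightarrow> wirtinger_bar \<phi> z = 0"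
    using r(3) by (rule wirtinger_eq_0_outside; blast)+
  then show "wirtinger \<phi> \<in> test_functions" "wirtinger_bar \<phi> \<in> test_functions"
    unfolding test_functions_iff using r(1,2) C_k_wirtinger[OF C] by blast+
qed

lemma test_functions_has_wirt:
  "\<phi> \<in> test_functions \<Longrightarrow> has_wirt \<phi> (wirtinger \<phi> z) (wirtinger_bar \<phi> z) z"
  by (rule differentiable_has_wirt[OF C_k_differentiable[OF test_functions_C_k]])

text \<open>For e > 0 the argument of \<open>flat_exp\<close> is positive exactly where |z|^2 < 1 -
  e. There is no plateau: for p = 1 the value stays below 1 but tends to 1 as e tends to 0. The
  polynomial is a parameter because differentiation, up to smooth factors, only replaces p by
  \<open>flat_deriv p\<close>.\<close>

definition cutoff :: "real \<Rightarrow> real poly \<Rightarrow> complex \<Rightarrow> complex" where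
  "cutoff e p z = of_real (flat_exp p ((1 - e - (cmod z)\<^sup>2) / e))"

lemma has_wirt_cutoff:
  assumes "e \<noteq> 0"
  shows "has_wirt (cutoff e p)
    (of_real (- 1 / e) * (cutoff e (flat_deriv p) z * cnj z))
    (of_real (- 1 / e) * (cutoff e (flat_deriv p) z * z)) z"
proof -
  have "(\<lambda>z. complex_of_real ((1 - e - (cmod z)\<^sup>2) / e)) =
      (\<lambda>z. of_real ((1 - e) / e) + of_real (- 1 / e) * (z * cnj z))"
    using assms by (auto simp: fun_eq_iff complex_norm_square[symmetric] field_simps)
  moreover have "has_wirt (\<lambda>z. of_real ((1 - e) / e) + of_real (- 1 / e) * (z * cnj z))
      (0 + of_real (- 1 / e) * (1 * cnj z + z * 0)) (0 + of_real (- 1 / e) * (0 * cnj z + z * 1)) z"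
    by (intro has_wirt_add has_wirt_const has_wirt_cmult has_wirt_mult has_wirt_ident has_wirt_cnj)
  ultimately have "has_wirt (\<lambda>z. complex_of_real ((1 - e - (cmod z)\<^sup>2) / e))
      (of_real (- 1 / e) * cnj z) (of_real (- 1 / e) * z) z"
    by simp
  from has_wirt_real_chain[OF flat_exp_has_derivative this, of p]
  show ?thesis
    unfolding cutoff_def by (simp only: mult_ac)
qed

lemma C_k_cutoff:
  assumes "e \<noteq> 0"
  shows "C_k k (cutoff e p)"
proof (induction k arbitrary: p)
  case 0
  have "cutoff e p differentiable_on UNIV"
    using has_wirtD(3)[OF has_wirt_cutoff[OF assms]]
    by (simp add: differentiable_on_def differentiable_at_withinI)
  then show ?case
    by (simp add: differentiable_imp_continuous_on)
next
  case (Suc k)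
  show ?case
    by (rule C_k_SucI[OF has_wirt_cutoff[OF assms]];
        intro C_k_mult C_k_const C_k_ident C_k_cnj Suc.IH)
qed

lemma cutoff_eq_0:
  assumes "0 < e" "1 - e \<le> (cmod z)\<^sup>2"
  shows "cutoff e p z = 0"
  using assms by (simp add: cutoff_def flat_exp_def zero_less_divide_iff)

lemma cutoff_test_function:
  assumes "0 < e" "e < 1" "\<And>k. C_k k a"
  shows "(\<lambda>z. cutoff e p z * a z) \<in> test_functions"
proof -
  have "cutoff e p z * a z = 0" if "sqrt (1 - e) < cmod z" for z
  proof -
    have "1 - e \<le> (cmod z)\<^sup>2"
      using that assms by (smt (verit) norm_ge_zero real_le_rsqrt sqrt_le_D)
    then show ?thesis
      by (simp add: cutoff_eq_0 assms(1))
  qed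
  moreover have "0 < sqrt (1 - e)" "sqrt (1 - e) < 1"
    using assms by auto
  moreover have "C_k k (\<lambda>z. cutoff e p z * a z)" for k
    using assms by (auto intro!: C_k_mult C_k_cutoff)
  ultimately show ?thesis
    unfolding test_functions_iff by blast
qed

section \<open>Integration by parts\<close>

lemma integrable_continuous_bounded_support:
  fixes g :: "complex \<Rightarrow> complex"
  assumes "continuous_on UNIV g" "\<And>z. r < cmod z \<Longrightarrow> g z = 0"
  shows "integrable lborel g"
proof -
  have "integrable lborel (\<lambda>z. indicator (cball 0 r) z *\<^sub>R g z)"
    using assms(1) by (intro borel_integrable_compact) (auto intro: continuous_on_subset)
  also have "(\<lambda>z. indicator (cball 0 r) z *\<^sub>R g z) = g"
    using assms(2) by (force simp: indicator_def not_le)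
  finally show ?thesis .
qed

lemma integral_translate_lborel:
  fixes g :: "complex \<Rightarrow> complex"
  assumes "g \<in> borel_measurable borel"
  shows "(LINT z|lborel. g (c + z)) = (LINT z|lborel. g z)"
proof -
  have "(LINT z|distr lborel borel ((+) c). g z) = (LINT z|lborel. g (c + z))"
    by (rule integral_distr) (use assms in auto)
  then show ?thesis
    by (simp add: lborel_distr_plus)
qed

text \<open>Translation invariance makes the integrals of difference quotients vanish.\<close>

lemma integral_directional_derivative_eq_0:
  fixes g D :: "complex \<Rightarrow> complex"
  assumes deriv: "\<And>z t. ((\<lambda>t. g (z + of_real t * d)) has_vector_derivative D (z + of_real t * d)) (at t)"
    and D: "continuous_on UNIV D" and g: "continuous_on UNIV g"
    and supp: "\<And>z. r < cmod z \<Longrightarrow> g z = 0"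
  shows "(LINT z|lborel. D z) = 0"
proof -
  define e where "e n = 1 / (real n + 1)" for n
  have e: "0 < e n" "e n \<le> 1" for n
    by (auto simp: e_def)
  have e0: "e \<longlonglongrightarrow> 0"
    unfolding e_def using LIMSEQ_inverse_real_of_nat by (simp add: inverse_eq_divide add.commute)
  define q where "q n z = (1 / e n) *\<^sub>R (g (of_real (e n) * d + z) - g z)" for n z
  have gm: "g \<in> borel_measurable borel"
    by (rule borel_measurable_continuous_onI[OF g])
  have gi: "integrable lborel g"
    by (rule integrable_continuous_bounded_support[OF g supp])
  have gi': "integrable lborel (\<lambda>z. g (c + z))" for c
  proof (rule integrable_continuous_bounded_support)
    show "continuous_on UNIV (\<lambda>z. g (c + z))"
      by (intro continuous_on_compose2[OF g] continuous_intros) auto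
    show "g (c + z) = 0" if "r + cmod c < cmod z" for z
      using norm_triangle_ineq4[of "c + z" c] that by (intro supp) simp
  qed
  have q0: "(LINT z|lborel. q n z) = 0" for n
    unfolding q_def using gi gi' by (simp add: integral_translate_lborel[OF gm])
  \<comment> \<open>Since \<open>e n\<close> is at most 1, a difference quotient can be nonzero only
    for |z| <= r + |d|, and the segment that it spans from there stays within radius r + 2
    |d|.\<close>
  have "compact (D ` cball 0 (r + 2 * cmod d))"
    by (intro compact_continuous_image continuous_on_subset[OF D]) auto
  then obtain B where B: "\<And>z. cmod z \<le> r + 2 * cmod d \<Longrightarrow> cmod (D z) \<le> B"
    using compact_imp_bounded by (force simp: bounded_iff)
  have lip: "cmod (q n z) \<le> indicator (cball 0 (r + cmod d)) z * B" for n z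
  proof (cases "cmod z \<le> r + cmod d")
    case True
    have "cmod (g (z + of_real (e n) * d) - g (z + of_real 0 * d)) \<le> B * norm (e n - 0)"
    proof (rule differentiable_bound[where S="{0..e n}" and f'="\<lambda>t h. h *\<^sub>R D (z + of_real t * d)"])
      fix t assume t: "t \<in> {0..e n}"
      show "((\<lambda>t. g (z + of_real t * d)) has_derivative (\<lambda>h. h *\<^sub>R D (z + of_real t * d))) (at t within {0..e n})"
        using deriv[of z t] by (simp add: has_vector_derivative_def has_derivative_at_withinI)
      have "cmod (of_real t * d) \<le> cmod d"
        using t e[of n] by (simp add: norm_mult mult_left_le_one_le)
      then have "cmod (z + of_real t * d) \<le> r + 2 * cmod d"
        using norm_triangle_ineq[of z "of_real t * d"] True by linarith
      then have "cmod (D (z + of_real t * d)) \<le> B"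
        by (rule B)
      then show "onorm (\<lambda>h. h *\<^sub>R D (z + of_real t * d)) \<le> B"
        by (intro onorm_bound) (auto simp: mult.commute[of B] intro: mult_left_mono order_trans[OF norm_ge_zero])
    qed (use e[of n] in auto)
    moreover have "cmod (q n z) = cmod (g (z + of_real (e n) * d) - g z) / e n"
      using e[of n] unfolding q_def norm_scaleR by (simp add: add.commute)
    ultimately show ?thesis
      using True e[of n] by (simp add: pos_divide_le_eq)
  next
    case False
    have "cmod (of_real (e n) * d) \<le> cmod d"
      using e[of n] by (simp add: norm_mult mult_left_le_one_le)
    then have "r < cmod (of_real (e n) * d + z)"
      using False norm_triangle_ineq4[of "of_real (e n) * d + z" "of_real (e n) * d"] by simp
    moreover have "r < cmod z"
      using False norm_ge_zero[of d] by linarith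
    ultimately show ?thesis
      using False by (simp add: q_def supp)
  qed
  have lim: "(\<lambda>n. q n z) \<longlonglongrightarrow> D z" for z
  proof -
    have "((\<lambda>t. norm (g (z + of_real (0 + t) * d) - g (z + of_real 0 * d) - t *\<^sub>R D (z + of_real 0 * d)) / norm t)
        \<longlongrightarrow> 0) (at 0)"
      using deriv[of z 0] unfolding has_vector_derivative_def has_derivative_at by blast
    then have "(\<lambda>n. norm (g (z + of_real (0 + e n) * d) - g (z + of_real 0 * d) - e n *\<^sub>R D (z + of_real 0 * d)) / norm (e n))
        \<longlonglongrightarrow> 0"
      by (rule filterlim_compose) (use e0 e in \<open>auto simp: filterlim_at less_imp_neq[symmetric] intro!: always_eventually\<close>)
    moreover have "norm (g (z + of_real (0 + e n) * d) - g (z + of_real 0 * d) - e n *\<^sub>R D (z + of_real 0 * d)) / norm (e n)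
        = norm (q n z - D z)" for n
    proof -
      have "q n z - D z = (1 / e n) *\<^sub>R (g (z + of_real (0 + e n) * d) - g (z + of_real 0 * d) - e n *\<^sub>R D (z + of_real 0 * d))"
        using e[of n] by (simp add: q_def scaleR_diff_right add.commute)
      then show ?thesis
        using e[of n] by simp
    qed
    ultimately show ?thesis
      by (simp add: tendsto_norm_zero_iff LIM_zero_iff)
  qed
  have "(\<lambda>n. LINT z|lborel. q n z) \<longlonglongrightarrow> (LINT z|lborel. D z)"
  proof (rule integral_dominated_convergence)
    show "integrable lborel (\<lambda>z. indicator (cball 0 (r + cmod d)) z * B)"
      by (intro integrable_mult_left integrable_real_indicator emeasure_lborel_cball_finite) auto
    show "D \<in> borel_measurable lborel"
      using borel_measurable_continuous_onI[OF D] by simp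
    show "q n \<in> borel_measurable lborel" for n
      unfolding q_def using borel_measurable_integrable[OF gi] borel_measurable_integrable[OF gi'] by measurable
  qed (use lim lip in auto)
  then show ?thesis
    by (simp add: q0 LIMSEQ_const_iff)
qed

text \<open>The derivative in direction d is a d + b cnj d. Taking d = 1 and d = \<i> shows that the
  sum and the difference of the two integrals vanish.\<close>

lemma integral_wirt_eq_0:
  assumes w: "\<And>z. has_wirt g (a z) (b z) z"
    and a: "continuous_on UNIV a" and b: "continuous_on UNIV b"
    and supp: "\<And>z. r < cmod z \<Longrightarrow> g z = 0"
  shows "(LINT z|lborel. a z) = 0" "(LINT z|lborel. b z) = 0"
proof -
  have g: "continuous_on UNIV g"
    using has_wirtD(3)[OF w] by (simp add: continuous_at_imp_continuous_on differentiable_imp_continuous_within)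
  have *: "(LINT z|lborel. a z * d + b z * cnj d) = 0" for d
  proof (rule integral_directional_derivative_eq_0[OF _ _ g supp])
    fix z t
    have "((\<lambda>t. z + of_real t * d) has_derivative (\<lambda>h. of_real h * d)) (at t)"
      by (auto intro!: derivative_eq_intros)
    from has_derivative_compose[OF this w[of "z + of_real t * d", unfolded has_wirt_def]]
    show "((\<lambda>t. g (z + of_real t * d)) has_vector_derivative
        a (z + of_real t * d) * d + b (z + of_real t * d) * cnj d) (at t)"
      by (simp add: has_vector_derivative_def scaleR_conv_of_real algebra_simps)
  qed (intro continuous_intros a b)
  have "a z = 0" "b z = 0" if "r < cmod z" for z
    using has_wirt_unique[OF w has_wirt_locally_zero[OF open_norm_greater, of z r g]] supp that by auto
  then have i: "integrable lborel a" "integrable lborel b"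
    by (auto intro!: integrable_continuous_bounded_support[OF a] integrable_continuous_bounded_support[OF b])
  have "(LINT z|lborel. a z) + (LINT z|lborel. b z) = 0"
    using *[of 1] i by simp
  moreover have "(LINT z|lborel. a z) * \<i> - (LINT z|lborel. b z) * \<i> = 0"
    using *[of \<i>] i by simp
  ultimately show "(LINT z|lborel. a z) = 0" "(LINT z|lborel. b z) = 0"
    by (auto simp: complex_eq_iff)
qed

lemma continuous_on_extend_zero:
  fixes w :: "complex \<Rightarrow> complex"
  assumes "continuous_on disk w" "r < 1" "\<And>z. r < cmod z \<Longrightarrow> w z = 0"
  shows "continuous_on UNIV (\<lambda>z. if z \<in> disk then w z else 0)"
proof -
  have "continuous_on (disk \<union> {z. r < cmod z}) (\<lambda>z. if z \<in> disk then w z else 0)"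
  proof (rule continuous_on_open_Un)
    show "continuous_on disk (\<lambda>z. if z \<in> disk then w z else 0)"
      using assms(1) by (rule continuous_on_eq) simp
    show "continuous_on {z. r < cmod z} (\<lambda>z. if z \<in> disk then w z else 0)"
      by (rule continuous_on_eq[OF continuous_on_const[of _ 0]]) (simp add: assms(3))
  qed (auto intro: open_norm_greater)
  also have "disk \<union> {z. r < cmod z} = UNIV"
    using assms(2) by auto
  finally show ?thesis .
qed

lemma integral_lebesgue_on_disk:
  fixes w :: "complex \<Rightarrow> complex"
  assumes "(\<lambda>z. if z \<in> disk then w z else 0) \<in> borel_measurable borel"
  shows "(LINT z|lebesgue_on disk. w z) = (LINT z|lborel. (if z \<in> disk then w z else 0))"
proof -
  have "(LINT z|lebesgue_on disk. w z) = (LINT z|lebesgue. indicator disk z *\<^sub>R w z)"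
    by (rule integral_restrict_space) auto
  also have "(\<lambda>z. indicator disk z *\<^sub>R w z) = (\<lambda>z. if z \<in> disk then w z else 0)"
    by (auto simp: indicator_def)
  also have "(LINT z|lebesgue. (if z \<in> disk then w z else 0)) = (LINT z|lborel. (if z \<in> disk then w z else 0))"
    using assms by (intro integral_completion) auto
  finally show ?thesis .
qed

text \<open>Because \<open>\<phi>\<close> vanishes near the boundary circle,
  \<open>u * \<phi>\<close> extended by zero is differentiable on the whole plane, and the integrals
  of its Wirtinger derivatives are 0. So \<open>u\<close> may be holomorphic with arbitrary growth
  at the boundary.\<close>

lemma integral_by_parts_disk:
  assumes u: "\<And>z. z \<in> disk \<Longrightarrow> has_wirt u (a z) (b z) z"
    and a: "continuous_on disk a" and b: "continuous_on disk b"
    and \<phi>: "\<phi> \<in> test_functions"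
  shows "(LINT z|lebesgue_on disk. u z * wirtinger \<phi> z) = - (LINT z|lebesgue_on disk. a z * \<phi> z)"
    and "(LINT z|lebesgue_on disk. u z * wirtinger_bar \<phi> z) = - (LINT z|lebesgue_on disk. b z * \<phi> z)"
proof -
  obtain r where r: "0 < r" "r < 1" "\<And>z. r < cmod z \<Longrightarrow> \<phi> z = 0"
    using test_functionsE[OF \<phi>] by blast
  have "\<And>z. r < cmod z \<Longrightarrow> wirtinger \<phi> z = 0" "\<And>z. r < cmod z \<Longrightarrow> wirtinger_bar \<phi> z = 0"
    using r(3) by (rule wirtinger_eq_0_outside; blast)+
  note out = r(3) this
  define ext where "ext w z = (if z \<in> disk then w z else 0)" for w :: "complex \<Rightarrow> complex" and z
  have uc: "continuous_on disk u"
    by (auto intro!: continuous_at_imp_continuous_on differentiable_imp_continuous_within has_wirtD(3)[OF u])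
  have c: "continuous_on disk \<phi>" "continuous_on disk (wirtinger \<phi>)" "continuous_on disk (wirtinger_bar \<phi>)"
    using C_k_continuous[OF test_functions_C_k] test_functions_wirtinger[OF \<phi>] \<phi>
    by (auto intro: continuous_on_subset)
  have ext: "continuous_on UNIV (ext w) \<and> integrable lborel (ext w) \<and>
      (LINT z|lebesgue_on disk. w z) = (LINT z|lborel. ext w z)"
    if "continuous_on disk w" "\<And>z. r < cmod z \<Longrightarrow> w z = 0" for w
  proof -
    have *: "continuous_on UNIV (ext w)"
      unfolding ext_def by (rule continuous_on_extend_zero[OF that(1) r(2) that(2)])
    moreover have "ext w z = 0" if "r < cmod z" for z
      using \<open>r < cmod z\<close> \<open>\<And>z. r < cmod z \<Longrightarrow> w z = 0\<close> by (simp add: ext_def)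
    then have "integrable lborel (ext w)"
      by (rule integrable_continuous_bounded_support[OF *])
    moreover have "(LINT z|lebesgue_on disk. w z) = (LINT z|lborel. ext w z)"
      unfolding ext_def
      by (rule integral_lebesgue_on_disk[OF borel_measurable_continuous_onI[OF *[unfolded ext_def]]])
    ultimately show ?thesis
      by blast
  qed
  have w: "has_wirt (ext (\<lambda>z. u z * \<phi> z))
      (ext (\<lambda>z. a z * \<phi> z) z + ext (\<lambda>z. u z * wirtinger \<phi> z) z)
      (ext (\<lambda>z. b z * \<phi> z) z + ext (\<lambda>z. u z * wirtinger_bar \<phi> z) z) z" for z
  proof (cases "z \<in> disk")
    case True
    have "has_wirt (\<lambda>z. u z * \<phi> z) (a z * \<phi> z + u z * wirtinger \<phi> z) (b z * \<phi> z + u z * wirtinger_bar \<phi> z) z"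
      by (intro has_wirt_mult u True test_functions_has_wirt \<phi>)
    then show ?thesis
      using True unfolding has_wirt_def ext_def
      by (auto intro: has_derivative_transform_within_open[of _ _ _ _ disk])
  next
    case False
    have "has_wirt (ext (\<lambda>z. u z * \<phi> z)) 0 0 z"
      by (rule has_wirt_locally_zero[OF open_norm_greater, of _ r]) (use False r in \<open>auto simp: ext_def\<close>)
    then show ?thesis
      using False by (simp add: ext_def)
  qed
  have 1: "continuous_on disk (\<lambda>z. a z * \<phi> z)" "continuous_on disk (\<lambda>z. u z * wirtinger \<phi> z)"
       "continuous_on disk (\<lambda>z. b z * \<phi> z)" "continuous_on disk (\<lambda>z. u z * wirtinger_bar \<phi> z)"
    by (intro continuous_intros a b uc c)+
  note E = ext[OF 1(1)] ext[OF 1(2)] ext[OF 1(3)] ext[OF 1(4)]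
  have 2: "ext (\<lambda>z. u z * \<phi> z) z = 0" if "r < cmod z" for z
    using out that by (simp add: ext_def)
  have "(LINT z|lborel. ext (\<lambda>z. a z * \<phi> z) z + ext (\<lambda>z. u z * wirtinger \<phi> z) z) = 0"
       "(LINT z|lborel. ext (\<lambda>z. b z * \<phi> z) z + ext (\<lambda>z. u z * wirtinger_bar \<phi> z) z) = 0"
    using integral_wirt_eq_0[OF w _ _ 2] E out by (auto intro!: continuous_on_add)
  then show "(LINT z|lebesgue_on disk. u z * wirtinger \<phi> z) = - (LINT z|lebesgue_on disk. a z * \<phi> z)"
    and "(LINT z|lebesgue_on disk. u z * wirtinger_bar \<phi> z) = - (LINT z|lebesgue_on disk. b z * \<phi> z)"
    using out E by (auto simp: add_eq_0_iff2 algebra_simps)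
qed

section \<open>Square-integrable functions and density of polynomials\<close>

abbreviation diskM :: "complex measure" where
  "diskM \<equiv> lebesgue_on disk"

lemma finite_measure_diskM: "finite_measure diskM"
  by (rule finite_measure_lebesgue_on) simp

lemma diskM_integrable_const: "integrable diskM (\<lambda>_. c :: 'a :: {banach, second_countable_topology})"
  by (rule finite_measure.integrable_const[OF finite_measure_diskM])

lemma measurable_diskM_continuous:
  fixes f :: "complex \<Rightarrow> 'b :: {second_countable_topology, real_normed_vector}"
  shows "continuous_on disk f \<Longrightarrow> f \<in> borel_measurable diskM"
  by (rule continuous_imp_measurable_on_sets_lebesgue) auto

lemma L2_diskI_bound:
  assumes "f \<in> borel_measurable diskM" "integrable diskM w"
    and "\<And>z. z \<in> disk \<Longrightarrow> (cmod (f z))\<^sup>2 \<le> w z"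
  shows "f \<in> L2_disk"
proof -
  have "integrable diskM (\<lambda>z. (cmod (f z))\<^sup>2)"
  proof (rule Bochner_Integration.integrable_bound[OF assms(2)])
    show "AE z in diskM. norm ((cmod (f z))\<^sup>2) \<le> norm (w z)"
    proof (rule AE_I2)
      fix z assume "z \<in> space diskM"
      then have "(cmod (f z))\<^sup>2 \<le> w z"
        by (intro assms(3)) simp
      then show "norm ((cmod (f z))\<^sup>2) \<le> norm (w z)"
        by simp
    qed
  qed (use assms(1) in measurable)
  then show ?thesis
    using assms(1) by (simp add: L2_disk_def)
qed

lemma L2_diskI_bounded:
  assumes "f \<in> borel_measurable diskM" "\<And>z. z \<in> disk \<Longrightarrow> cmod (f z) \<le> B"
  shows "f \<in> L2_disk"
  by (rule L2_diskI_bound[OF assms(1) diskM_integrable_const[of "B\<^sup>2"]])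
     (use assms(2) in \<open>auto intro: power_mono\<close>)

lemma L2_diskD:
  assumes "f \<in> L2_disk"
  shows "f \<in> borel_measurable diskM" "integrable diskM (\<lambda>z. (cmod (f z))\<^sup>2)" "integrable diskM f"
proof -
  show m: "f \<in> borel_measurable diskM" and i: "integrable diskM (\<lambda>z. (cmod (f z))\<^sup>2)"
    using assms by (auto simp: L2_disk_def)
  have "cmod (f z) \<le> 1 + (cmod (f z))\<^sup>2" for z
  proof -
    have "0 \<le> (cmod (f z) - 1)\<^sup>2 + cmod (f z)" by simp
    then show ?thesis by (simp add: power2_diff)
  qed
  then show "integrable diskM f"
    using m by (intro Bochner_Integration.integrable_bound[OF Bochner_Integration.integrable_add[OF
          diskM_integrable_const[of "1::real"] i]]) (auto intro!: AE_I2)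
qed

lemma L2_disk_mult_bounded:
  assumes "f \<in> L2_disk" "b \<in> borel_measurable diskM" "\<And>z. z \<in> disk \<Longrightarrow> cmod (b z) \<le> B"
  shows "(\<lambda>z. f z * b z) \<in> L2_disk"
proof (rule L2_diskI_bound)
  show "integrable diskM (\<lambda>z. B\<^sup>2 * (cmod (f z))\<^sup>2)"
    using L2_diskD(2)[OF assms(1)] by simp
  show "(\<lambda>z. f z * b z) \<in> borel_measurable diskM"
    using L2_diskD(1)[OF assms(1)] assms(2) by measurable
  show "(cmod (f z * b z))\<^sup>2 \<le> B\<^sup>2 * (cmod (f z))\<^sup>2" if "z \<in> disk" for z
    using power_mono[OF assms(3)[OF that], of 2]
    by (simp add: norm_mult power_mult_distrib mult.commute mult_right_mono)
qed

lemma cmod_add_squared_le: "(cmod (a + b))\<^sup>2 \<le> 2 * (cmod a)\<^sup>2 + 2 * (cmod b)\<^sup>2"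
proof -
  have "(cmod (a + b))\<^sup>2 \<le> (cmod a + cmod b)\<^sup>2"
    by (intro power_mono norm_triangle_ineq) auto
  also have "\<dots> \<le> 2 * (cmod a)\<^sup>2 + 2 * (cmod b)\<^sup>2"
    using zero_le_power2[of "cmod a - cmod b"] by (simp add: power2_eq_square algebra_simps)
  finally show ?thesis .
qed

lemma L2_disk_add:
  assumes "f \<in> L2_disk" "g \<in> L2_disk"
  shows "(\<lambda>z. f z + g z) \<in> L2_disk"
  by (rule L2_diskI_bound[of _ "\<lambda>z. 2 * (cmod (f z))\<^sup>2 + 2 * (cmod (g z))\<^sup>2"])
     (use L2_diskD[OF assms(1)] L2_diskD[OF assms(2)] cmod_add_squared_le in auto)

lemma L2_disk_cmult: "f \<in> L2_disk \<Longrightarrow> (\<lambda>z. c * f z) \<in> L2_disk"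
  using L2_disk_mult_bounded[of f "\<lambda>_. c" "cmod c"] by (simp add: mult.commute)

lemma L2_disk_diff:
  assumes "f \<in> L2_disk" "g \<in> L2_disk"
  shows "(\<lambda>z. f z - g z) \<in> L2_disk"
  using L2_disk_add[OF assms(1) L2_disk_cmult[OF assms(2), of "-1"]] by simp

lemma continuous_cball_bounded:
  fixes f :: "complex \<Rightarrow> complex"
  assumes "continuous_on (cball 0 r) f"
  obtains B where "\<And>z. cmod z \<le> r \<Longrightarrow> cmod (f z) \<le> B"
proof -
  have "bounded (f ` cball 0 r)"
    by (intro compact_imp_bounded compact_continuous_image assms) auto
  then show ?thesis
    using that unfolding bounded_iff by (metis dist_0_norm image_eqI mem_cball)
qed

lemma L2_disk_continuous:
  assumes "continuous_on (cball 0 1) f"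
  shows "f \<in> L2_disk"
proof -
  obtain B where "\<And>z. cmod z \<le> 1 \<Longrightarrow> cmod (f z) \<le> B"
    using continuous_cball_bounded[OF assms] by blast
  then show ?thesis
    by (intro L2_diskI_bounded[where B=B] measurable_diskM_continuous continuous_on_subset[OF assms]) auto
qed

lemma L2_disk_mult_continuous:
  assumes "f \<in> L2_disk" "continuous_on (cball 0 1) g"
  shows "(\<lambda>z. f z * g z) \<in> L2_disk"
proof -
  obtain B where "\<And>z. cmod z \<le> 1 \<Longrightarrow> cmod (g z) \<le> B"
    using continuous_cball_bounded[OF assms(2)] by blast
  then show ?thesis
    by (intro L2_disk_mult_bounded[OF assms(1), where B=B] measurable_diskM_continuous
        continuous_on_subset[OF assms(2)]) auto
qed

text \<open>Finite sums of monomials, generated one term at a time, so that a linear statement about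
  integrals reduces by induction to a single monomial without double sums.\<close>

inductive zpoly :: "(complex \<Rightarrow> complex) \<Rightarrow> bool" where
  zero: "zpoly (\<lambda>_. 0)"
| step: "zpoly p \<Longrightarrow> zpoly (\<lambda>z. p z + c * (z ^ j * cnj z ^ k))"

lemma zpoly_add:
  assumes "zpoly p" "zpoly q"
  shows "zpoly (\<lambda>z. p z + q z)"
  using assms(2)
proof induction
  case (step q c j k)
  then show ?case
    using zpoly.step[of "\<lambda>z. p z + q z" c j k] by (simp add: add.assoc)
qed (simp add: assms(1))

lemma zpoly_mult_mon: "zpoly p \<Longrightarrow> zpoly (\<lambda>z. c * (z ^ j * cnj z ^ k) * p z)"
proof (induction p rule: zpoly.induct)
  case (step q d m n)
  have "(\<lambda>z. c * (z ^ j * cnj z ^ k) * (q z + d * (z ^ m * cnj z ^ n))) =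
    (\<lambda>z. c * (z ^ j * cnj z ^ k) * q z + (c * d) * (z ^ (j + m) * cnj z ^ (k + n)))"
    by (simp add: fun_eq_iff algebra_simps power_add)
  then show ?case
    using zpoly.step[OF step.IH] by simp
qed (simp add: zpoly.zero)

lemma zpoly_mult: "zpoly p \<Longrightarrow> zpoly q \<Longrightarrow> zpoly (\<lambda>z. p z * q z)"
proof (induction p rule: zpoly.induct)
  case (step p c j k)
  then show ?case
    using zpoly_add[OF _ zpoly_mult_mon[of q c j k]] by (simp add: distrib_right)
qed (simp add: zpoly.zero)

lemma zpoly_mon: "zpoly (\<lambda>z. z ^ j * cnj z ^ k)"
  using zpoly.step[OF zpoly.zero, of 1 j k] by simp

lemma zpoly_const: "zpoly (\<lambda>_. c)"
  using zpoly.step[OF zpoly.zero, of c 0 0] by simp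

lemma zpoly_ident: "zpoly (\<lambda>z. z)"
  using zpoly_mon[of 1 0] by simp

lemma zpoly_cnj: "zpoly cnj"
  using zpoly_mon[of 0 1] by simp

lemma zpoly_diff: "zpoly p \<Longrightarrow> zpoly q \<Longrightarrow> zpoly (\<lambda>z. p z - q z)"
  using zpoly_add[OF _ zpoly_mult[OF zpoly_const[of "-1"]], of p q] by simp

lemma zpoly_power: "zpoly p \<Longrightarrow> zpoly (\<lambda>z. p z ^ n)"
  by (induction n) (auto intro: zpoly_const zpoly_mult)

lemma C_k_zpoly: "zpoly p \<Longrightarrow> C_k k p"
  by (induction rule: zpoly.induct)
     (auto intro!: C_k_const C_k_add C_k_mult C_k_power C_k_ident C_k_cnj)

lemma continuous_on_zpoly: "zpoly p \<Longrightarrow> continuous_on S p"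
  using C_k_continuous[OF C_k_zpoly] continuous_on_subset by blast

lemma L2_disk_zpoly: "zpoly p \<Longrightarrow> p \<in> L2_disk"
  by (intro L2_disk_continuous continuous_on_zpoly)

text \<open>The Stone-Weierstrass theorem yields polynomials in real-linear functionals. Such a
  functional f has the form a z + b cnj z with a = (f 1 - \<i> f \<i>) / 2 and b the conjugate of
  a.\<close>

lemma zpoly_real_polynomial_function:
  fixes f :: "complex \<Rightarrow> real"
  assumes "real_polynomial_function f"
  shows "zpoly (\<lambda>z. of_real (f z))"
  using assms
proof (induction rule: real_polynomial_function.induct)
  case (linear f)
  then interpret bounded_linear f .
  have "complex_of_real (f z) =
      ((f 1 - \<i> * f \<i>) / 2) * z + ((f 1 + \<i> * f \<i>) / 2) * cnj z" for z
  proof -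
    have "f z = f (Re z *\<^sub>R 1 + Im z *\<^sub>R \<i>)"
      by (rule arg_cong[where f=f]) (simp add: complex_eq_iff)
    also have "\<dots> = Re z * f 1 + Im z * f \<i>"
      unfolding add scaleR by simp
    finally show ?thesis
      by (simp add: complex_eq_iff field_simps flip: of_real_mult)
  qed
  then have "(\<lambda>z. complex_of_real (f z)) =
      (\<lambda>z. ((f 1 - \<i> * f \<i>) / 2) * z + ((f 1 + \<i> * f \<i>) / 2) * cnj z)"
    by (rule ext)
  moreover have "zpoly (\<lambda>z. ((f 1 - \<i> * f \<i>) / 2) * z + ((f 1 + \<i> * f \<i>) / 2) * cnj z)"
    by (intro zpoly_add zpoly_mult[OF zpoly_const] zpoly_ident zpoly_cnj)
  ultimately show ?case
    by (simp only:)
qed (simp_all add: zpoly_const zpoly_add zpoly_mult)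

lemma zpoly_polynomial_function:
  fixes f :: "complex \<Rightarrow> complex"
  assumes "polynomial_function f"
  shows "zpoly f"
proof -
  have "real_polynomial_function (\<lambda>z. Re (f z))" "real_polynomial_function (\<lambda>z. Im (f z))"
    using assms bounded_linear_Re bounded_linear_Im by (auto simp: polynomial_function_def o_def)
  then have "zpoly (\<lambda>z. of_real (Re (f z)) + \<i> * of_real (Im (f z)))"
    by (intro zpoly_add zpoly_mult[OF zpoly_const] zpoly_real_polynomial_function)
  then show ?thesis
    by (simp flip: complex_eq)
qed

text \<open>Distances are kept squared, and |u + v|^2 <= 2 |u|^2 + 2 |v|^2 replaces Minkowski's
  inequality. This is the origin of the quarters of \<open>\<epsilon>\<close> below.\<close>

lemma L2_dist_triangle:
  assumes "f \<in> L2_disk" "g \<in> L2_disk" "h \<in> L2_disk"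
  shows "(LINT z|diskM. (cmod (f z - h z))\<^sup>2) \<le>
    2 * (LINT z|diskM. (cmod (f z - g z))\<^sup>2) + 2 * (LINT z|diskM. (cmod (g z - h z))\<^sup>2)"
proof -
  have i: "integrable diskM (\<lambda>z. (cmod (f z - h z))\<^sup>2)" "integrable diskM (\<lambda>z. (cmod (f z - g z))\<^sup>2)"
     "integrable diskM (\<lambda>z. (cmod (g z - h z))\<^sup>2)"
    using assms by (auto intro!: L2_diskD(2) L2_disk_diff)
  have "(LINT z|diskM. (cmod (f z - h z))\<^sup>2) \<le>
    (LINT z|diskM. 2 * (cmod (f z - g z))\<^sup>2 + 2 * (cmod (g z - h z))\<^sup>2)"
  proof (rule integral_mono)
    show "(cmod (f z - h z))\<^sup>2 \<le> 2 * (cmod (f z - g z))\<^sup>2 + 2 * (cmod (g z - h z))\<^sup>2" for z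
      using cmod_add_squared_le[of "f z - g z" "g z - h z"] by simp
  qed (use i in auto)
  then show ?thesis
    using i by simp
qed

text \<open>The projection \<open>T m\<close> to the closed ball of radius m serves twice. It
  replaces \<open>F\<close> by a bounded function at small cost, and it makes continuous functions
  that converge to \<open>F\<close> almost everywhere uniformly bounded while keeping them
  continuous, so that dominated convergence applies.\<close>

lemma L2_approx_continuous:
  assumes F: "F \<in> L2_disk" and "0 < \<epsilon>"
  shows "\<exists>g. continuous_on UNIV g \<and> (LINT z|diskM. (cmod (F z - g z))\<^sup>2) < \<epsilon>"
proof -
  define T where "T m = closest_point (cball (0::complex) (real m))" for m
  have Tc: "continuous_on S (T m)" for S m
    unfolding T_def by (rule continuous_on_closest_point) auto
  have Tm: "T m \<in> borel_measurable borel" for m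
    by (rule borel_measurable_continuous_onI[OF Tc])
  have Tn: "cmod (T m w) \<le> real m" for m w
    using closest_point_in_set[of "cball 0 (real m)" w] by (auto simp: T_def)
  have Td: "cmod (w - T m w) \<le> cmod w" for m w
    using closest_point_le[of "cball 0 (real m)" 0 w] by (auto simp: T_def dist_norm)
  have Te: "T m w = w" if "cmod w \<le> real m" for m w
    using that by (auto simp: T_def intro: closest_point_self)
  note Fm = L2_diskD(1)[OF F]
  have TF: "(\<lambda>z. T m (F z)) \<in> borel_measurable diskM" for m
    by (rule measurable_compose[OF Fm Tm])
  have TL: "(\<lambda>z. T m (F z)) \<in> L2_disk" for m
    by (rule L2_diskI_bounded[OF TF Tn])
  have "(\<lambda>m. LINT z|diskM. (cmod (F z - T m (F z)))\<^sup>2) \<longlonglongrightarrow> (LINT z|diskM. (0::real))"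
  proof (rule integral_dominated_convergence)
    show "AE z in diskM. (\<lambda>m. (cmod (F z - T m (F z)))\<^sup>2) \<longlonglongrightarrow> 0"
    proof (rule AE_I2)
      fix z
      obtain N :: nat where N: "cmod (F z) \<le> real N"
        using real_arch_simple by blast
      have "\<forall>\<^sub>F m in sequentially. (cmod (F z - T m (F z)))\<^sup>2 = 0"
        using eventually_ge_at_top[of N] by eventually_elim (use N in \<open>simp add: Te\<close>)
      then show "(\<lambda>m. (cmod (F z - T m (F z)))\<^sup>2) \<longlonglongrightarrow> 0"
        by (rule tendsto_eventually)
    qed
    show "AE z in diskM. norm ((cmod (F z - T m (F z)))\<^sup>2) \<le> (cmod (F z))\<^sup>2" for m
      using Td by (auto intro: power_mono)
  qed (use Fm TF L2_diskD(2)[OF F] in auto)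
  then have "\<forall>\<^sub>F m in sequentially. (LINT z|diskM. (cmod (F z - T m (F z)))\<^sup>2) < \<epsilon> / 4"
    using assms(2) by (intro order_tendstoD) auto
  then obtain m where m: "(LINT z|diskM. (cmod (F z - T m (F z)))\<^sup>2) < \<epsilon> / 4"
    by (meson eventually_happens' sequentially_bot)
  have "F measurable_on disk"
    using Fm by (simp add: measurable_on_iff_borel_measurable)
  then obtain N g where N: "negligible N" and g: "\<And>n. continuous_on UNIV (g n)"
    and lim: "\<And>x. x \<notin> N \<Longrightarrow> (\<lambda>n. g n x) \<longlonglongrightarrow> (if x \<in> disk then F x else 0)"
    unfolding measurable_on_def by blast
  have Tg: "continuous_on UNIV (\<lambda>z. T m (g n z))" for n
    by (rule continuous_on_compose2[OF Tc g]) auto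
  have TgL: "(\<lambda>z. T m (g n z)) \<in> L2_disk" for n
    by (rule L2_disk_continuous[OF continuous_on_subset[OF Tg]]) auto
  have "(\<lambda>n. LINT z|diskM. (cmod (T m (F z) - T m (g n z)))\<^sup>2) \<longlonglongrightarrow> (LINT z|diskM. (0::real))"
  proof (rule integral_dominated_convergence)
    have "AE z in lebesgue. z \<notin> N"
      using N unfolding negligible_iff_null_sets by (rule AE_not_in)
    then have "AE z in lebesgue. z \<in> disk \<longrightarrow> (\<lambda>n. (cmod (T m (F z) - T m (g n z)))\<^sup>2) \<longlonglongrightarrow> 0"
    proof eventually_elim
      case (elim z)
      show ?case
      proof
        assume "z \<in> disk"
        then have "(\<lambda>n. T m (g n z)) \<longlonglongrightarrow> T m (F z)"
          using continuous_on_tendsto_compose[OF Tc[of UNIV m] lim[OF elim]] by simp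
        then have "(\<lambda>n. (cmod (T m (F z) - T m (g n z)))\<^sup>2) \<longlonglongrightarrow> (cmod (T m (F z) - T m (F z)))\<^sup>2"
          by (intro tendsto_intros)
        then show "(\<lambda>n. (cmod (T m (F z) - T m (g n z)))\<^sup>2) \<longlonglongrightarrow> 0"
          by simp
      qed
    qed
    then show "AE z in diskM. (\<lambda>n. (cmod (T m (F z) - T m (g n z)))\<^sup>2) \<longlonglongrightarrow> 0"
      by (simp add: AE_restrict_space_iff)
    show "AE z in diskM. norm ((cmod (T m (F z) - T m (g n z)))\<^sup>2) \<le> (2 * real m)\<^sup>2" for n
    proof (rule AE_I2)
      fix z
      have "cmod (T m (F z) - T m (g n z)) \<le> 2 * real m"
        using norm_triangle_ineq4[of "T m (F z)" "T m (g n z)"] Tn[of m "F z"] Tn[of m "g n z"] by linarith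
      then show "norm ((cmod (T m (F z) - T m (g n z)))\<^sup>2) \<le> (2 * real m)\<^sup>2"
        using power_mono[OF _ norm_ge_zero, of _ "2 * real m" 2] by simp
    qed
    show "integrable diskM (\<lambda>z. (2 * real m)\<^sup>2)"
      by (rule diskM_integrable_const)
  qed (use TF L2_diskD(1)[OF TgL] in auto)
  then have "\<forall>\<^sub>F n in sequentially. (LINT z|diskM. (cmod (T m (F z) - T m (g n z)))\<^sup>2) < \<epsilon> / 4"
    using assms(2) by (intro order_tendstoD) auto
  then obtain n where n: "(LINT z|diskM. (cmod (T m (F z) - T m (g n z)))\<^sup>2) < \<epsilon> / 4"
    by (meson eventually_happens' sequentially_bot)
  have "(LINT z|diskM. (cmod (F z - T m (g n z)))\<^sup>2) < \<epsilon>"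
    using L2_dist_triangle[OF F TL TgL, of n m] m n by linarith
  then show ?thesis
    using Tg by blast
qed

lemma L2_approx_zpoly:
  assumes F: "F \<in> L2_disk" and "0 < \<epsilon>"
  shows "\<exists>p. zpoly p \<and> (LINT z|diskM. (cmod (F z - p z))\<^sup>2) < \<epsilon>"
proof -
  obtain g where g: "continuous_on UNIV g" "(LINT z|diskM. (cmod (F z - g z))\<^sup>2) < \<epsilon> / 4"
    using L2_approx_continuous[OF F, of "\<epsilon> / 4"] assms(2) by auto
  define V where "V = measure diskM (space diskM)"
  have V: "0 \<le> V" by (simp add: V_def)
  \<comment> \<open>A uniform error d contributes at most d^2 V, with V the area of the disk. The
    denominator V + 1 makes this smaller than \<open>\<epsilon> / 4\<close> without any information
    on V beyond V >= 0.\<close>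
  define d where "d = sqrt (\<epsilon> / (4 * (V + 1)))"
  have d: "0 < d" "d\<^sup>2 = \<epsilon> / (4 * (V + 1))"
    using assms(2) V by (auto simp: d_def)
  obtain p where p: "polynomial_function p" "\<And>z. z \<in> cball 0 1 \<Longrightarrow> norm (g z - p z) < d"
    using Stone_Weierstrass_polynomial_function[OF compact_cball
        continuous_on_subset[OF g(1), of "cball 0 1"] d(1)] by fastforce
  have pz: "zpoly p"
    by (rule zpoly_polynomial_function[OF p(1)])
  have L: "g \<in> L2_disk" "p \<in> L2_disk"
    using g(1) by (auto intro!: L2_disk_continuous L2_disk_zpoly[OF pz] intro: continuous_on_subset)
  have "(LINT z|diskM. (cmod (g z - p z))\<^sup>2) \<le> (LINT z|diskM. d\<^sup>2)"
  proof (rule integral_mono)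
    show "(cmod (g z - p z))\<^sup>2 \<le> d\<^sup>2" if "z \<in> space diskM" for z
      using p(2)[of z] that by (intro power_mono) auto
  qed (use L2_diskD(2)[OF L2_disk_diff[OF L]] diskM_integrable_const in auto)
  also have "\<dots> = d\<^sup>2 * V"
    by (simp add: V_def)
  also have "\<dots> < \<epsilon> / 4"
    using V assms(2) by (simp add: d(2) field_simps)
  finally show ?thesis
    using L2_dist_triangle[OF F L] g(2) pz by (intro exI[of _ p]) auto
qed

lemma integral_mult_zpoly_eq_0:
  assumes "integrable diskM H" "\<And>j k. (LINT z|diskM. H z * (z ^ j * cnj z ^ k)) = 0" "zpoly p"
  shows "(LINT z|diskM. H z * p z) = 0"
  using assms(3)
proof induction
  case (step p c j k)
  have i: "integrable diskM (\<lambda>z. H z * q z)" if "zpoly q" for q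
  proof -
    obtain B where B: "\<And>z. cmod z \<le> 1 \<Longrightarrow> cmod (q z) \<le> B"
      using continuous_cball_bounded[OF continuous_on_zpoly[OF \<open>zpoly q\<close>]] by blast
    show ?thesis
    proof (rule Bochner_Integration.integrable_bound)
      show "integrable diskM (\<lambda>z. B * norm (H z))"
        using assms(1) by simp
      show "(\<lambda>z. H z * q z) \<in> borel_measurable diskM"
        using assms(1) measurable_diskM_continuous[OF continuous_on_zpoly[OF that]] by measurable
      show "AE z in diskM. norm (H z * q z) \<le> norm (B * norm (H z))"
        using B by (intro AE_I2) (auto simp: norm_mult mult.commute[of B] abs_mult
            intro!: mult_left_mono order_trans[OF B abs_ge_self])
    qed
  qed
  have "(LINT z|diskM. H z * (p z + c * (z ^ j * cnj z ^ k))) =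
    (LINT z|diskM. H z * p z + c * (H z * (z ^ j * cnj z ^ k)))"
    by (simp add: algebra_simps)
  then show ?case
    using i[OF step.hyps] i[OF zpoly_mon[of j k]] step.IH assms(2)[of j k] by simp
qed simp

text \<open>Let p approximate cnj H. The cross term of |cnj H - p|^2 is 2 Re (H p), whose integral
  vanishes by linearity, so the squared norm of H is at most that of cnj H - p. The conjugate is
  there because the moments pair H with polynomials bilinearly.\<close>

lemma AE_eq_0_if_moments_eq_0:
  assumes H: "H \<in> L2_disk" and moments: "\<And>j k. (LINT z|diskM. H z * (z ^ j * cnj z ^ k)) = 0"
  shows "AE z in diskM. H z = 0"
proof -
  have "(\<lambda>z. cnj (H z)) \<in> L2_disk"
    using measurable_compose[OF L2_diskD(1)[OF H] borel_measurable_continuous_onI[OF continuous_on_cnj[OF continuous_on_id]]] L2_diskD(2)[OF H]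
    by (simp add: L2_disk_def)
  have "(LINT z|diskM. (cmod (H z))\<^sup>2) \<le> 0 + e" if "0 < e" for e
  proof -
    obtain p where p: "zpoly p" "(LINT z|diskM. (cmod (cnj (H z) - p z))\<^sup>2) < e"
      using L2_approx_zpoly[OF \<open>(\<lambda>z. cnj (H z)) \<in> L2_disk\<close> \<open>0 < e\<close>] by blast
    have pL: "p \<in> L2_disk"
      by (rule L2_disk_zpoly[OF p(1)])
    define r where "r z = H z * p z" for z
    have eq: "(cmod (cnj (H z) - p z))\<^sup>2 = (cmod (H z))\<^sup>2 + (cmod (p z))\<^sup>2 - 2 * Re (r z)" for z
      unfolding cmod_power2 r_def by (simp add: power2_eq_square algebra_simps)
    have i: "integrable diskM r"
      unfolding r_def by (intro L2_diskD(3) L2_disk_mult_continuous H continuous_on_zpoly p)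
    have "(LINT z|diskM. (cmod (cnj (H z) - p z))\<^sup>2) =
        (LINT z|diskM. (cmod (H z))\<^sup>2) + (LINT z|diskM. (cmod (p z))\<^sup>2) - 2 * Re (LINT z|diskM. r z)"
      unfolding eq using i L2_diskD(2)[OF H] L2_diskD(2)[OF pL] by simp
    moreover have "0 \<le> (LINT z|diskM. (cmod (p z))\<^sup>2)"
      by simp
    moreover have "(LINT z|diskM. r z) = 0"
      unfolding r_def by (rule integral_mult_zpoly_eq_0[OF L2_diskD(3)[OF H] moments p(1)])
    ultimately show ?thesis
      using p(2) unfolding \<open>(LINT z|diskM. r z) = 0\<close> zero_complex.sel by linarith
  qed
  then have "(LINT z|diskM. (cmod (H z))\<^sup>2) \<le> 0"
    by (rule field_le_epsilon)
  then have "(LINT z|diskM. (cmod (H z))\<^sup>2) = 0"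
    by (intro antisym) auto
  then have "AE z in diskM. (cmod (H z))\<^sup>2 = 0"
    using integral_nonneg_eq_0_iff_AE[OF L2_diskD(2)[OF H]] by simp
  then show ?thesis
    by simp
qed

section \<open>The operator in divergence form\<close>

definition wgt :: "complex \<Rightarrow> complex" where
  "wgt z = 1 - z * cnj z"

lemma wgt_eq: "1 - complex_of_real ((cmod z)\<^sup>2) = wgt z"
  unfolding complex_norm_square wgt_def ..

lemma wgt_eq_of_real: "wgt z = of_real (1 - (cmod z)\<^sup>2)"
  unfolding wgt_eq[symmetric] by simp

lemma zpoly_wgt: "zpoly wgt"
  unfolding wgt_def[abs_def] by (intro zpoly_diff zpoly_const zpoly_mult zpoly_ident zpoly_cnj)

lemma has_wirt_wgt: "has_wirt wgt (- cnj z) (- z) z"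
proof -
  have "has_wirt (\<lambda>z. 1 + (-1) * (z * cnj z)) (0 + (-1) * (1 * cnj z + z * 0)) (0 + (-1) * (0 * cnj z + z * 1)) z"
    by (intro has_wirt_add has_wirt_const has_wirt_cmult has_wirt_mult has_wirt_ident has_wirt_cnj)
  then show ?thesis
    by (simp add: wgt_def[abs_def])
qed

lemma has_wirt_wgt_sq: "has_wirt (\<lambda>z. (wgt z)\<^sup>2) (- 2 * wgt z * cnj z) (- 2 * wgt z * z) z"
  using has_wirt_mult[OF has_wirt_wgt has_wirt_wgt, of z]
  by (simp add: power2_eq_square algebra_simps)

text \<open>The transpose, for the bilinear pairing, of the divergence form of the operator without
  its factor -4: the two derivatives change places.\<close>

definition wgt_op :: "(complex \<Rightarrow> complex) \<Rightarrow> complex \<Rightarrow> complex" where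
  "wgt_op \<phi> = wirtinger_bar (\<lambda>z. (wgt z)\<^sup>2 * wirtinger \<phi> z)"

lemma wgt_op_eq:
  assumes "C_k 2 \<phi>"
  shows "wgt_op \<phi> z = - 2 * wgt z * z * wirtinger \<phi> z + (wgt z)\<^sup>2 * wirtinger_bar (wirtinger \<phi>) z"
proof -
  have "C_k (Suc 0) (wirtinger \<phi>)"
    using assms C_k_wirtinger(1)[of "Suc 0"] by (simp add: numeral_2_eq_2)
  from has_wirt_mult[OF has_wirt_wgt_sq differentiable_has_wirt[OF C_k_differentiable[OF this]], of z]
  show ?thesis
    unfolding wgt_op_def by (simp add: has_wirtD(2))
qed

lemma integrable_L2_test:
  assumes "F \<in> L2_disk" "\<phi> \<in> test_functions"
  shows "integrable diskM (\<lambda>z. F z * \<phi> z)"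
  using assms continuous_on_subset[OF C_k_continuous[OF test_functions_C_k]]
  by (intro L2_diskD(3) L2_disk_mult_continuous) auto

lemma wgt_op_test:
  assumes "\<phi> \<in> test_functions"
  shows "wgt_op \<phi> \<in> test_functions"
  unfolding wgt_op_def
  by (intro test_functions_wirtinger test_functions_mult assms C_k_power C_k_zpoly zpoly_wgt)

text \<open>The first-order term of the operator is what the product rule produces when d/dz falls
  on the weight, since d/dz (1 - |z|^2)^2 = - 2 (1 - |z|^2) cnj z. Hence the terms with
  undifferentiated \<open>\<phi>\<close> cancel in \<open>wirtinger A + B\<close>.\<close>

lemma Delta_tilde_dist_of:
  assumes F: "F \<in> L2_disk" and \<phi>: "\<phi> \<in> test_functions"
  shows "Delta_tilde (dist_of F) \<phi> = - 4 * (LINT z|diskM. F z * wgt_op \<phi> z)"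
proof -
  define A where "A z = wgt z * (- 4 * wgt z * \<phi> z)" for z
  define B where "B z = 2 * cnj z * (- 4 * wgt z * \<phi> z)" for z
  have AB: "A \<in> test_functions" "B \<in> test_functions"
    unfolding A_def[abs_def] B_def[abs_def]
    by (intro test_functions_mult \<phi> C_k_mult C_k_const C_k_cnj C_k_zpoly[OF zpoly_wgt])+
  have "wirtinger A z = - 4 * ((wgt z)\<^sup>2 * wirtinger \<phi> z) - B z" for z
  proof -
    have "A = (\<lambda>z. - 4 * ((wgt z)\<^sup>2 * \<phi> z))"
      by (simp add: A_def fun_eq_iff power2_eq_square)
    then have "wirtinger A z = - 4 * (- 2 * wgt z * cnj z * \<phi> z + (wgt z)\<^sup>2 * wirtinger \<phi> z)"
      using has_wirtD(1)[OF has_wirt_cmult[OF has_wirt_mult[OF has_wirt_wgt_sq test_functions_has_wirt[OF \<phi>]], of "-4" z]]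
      by simp
    then show ?thesis
      by (simp add: B_def algebra_simps)
  qed
  then have eq: "(\<lambda>z. wirtinger A z + B z) = (\<lambda>z. - 4 * ((wgt z)\<^sup>2 * wirtinger \<phi> z))"
    by simp
  have t: "(\<lambda>z. (wgt z)\<^sup>2 * wirtinger \<phi> z) \<in> test_functions"
    by (intro test_functions_wirtinger test_functions_mult \<phi> C_k_power C_k_zpoly zpoly_wgt)
  have "wirtinger_bar (wirtinger A) z + wirtinger_bar B z = - 4 * wgt_op \<phi> z" for z
    using has_wirtD(2)[OF has_wirt_add[OF test_functions_has_wirt[OF test_functions_wirtinger(1)[OF AB(1)]]
          test_functions_has_wirt[OF AB(2)], of z]]
      has_wirtD(2)[OF has_wirt_cmult[OF test_functions_has_wirt[OF t], of "-4" z]]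
    unfolding eq wgt_op_def by simp
  then have *: "F z * wirtinger_bar (wirtinger A) z + F z * wirtinger_bar B z = - 4 * (F z * wgt_op \<phi> z)" for z
    by (simp add: algebra_simps flip: distrib_left)
  have "Delta_tilde (dist_of F) \<phi> =
      (LINT z|diskM. F z * wirtinger_bar (wirtinger A) z) + (LINT z|diskM. F z * wirtinger_bar B z)"
    by (simp only: Delta_tilde_def dist_mult_def dist_diff_def dist_dz_def dist_dzbar_def dist_of_def
        wgt_eq A_def[abs_def] B_def[abs_def] minus_minus diff_minus_eq_add)
  also have "\<dots> = (LINT z|diskM. F z * wirtinger_bar (wirtinger A) z + F z * wirtinger_bar B z)"
    by (intro Bochner_Integration.integral_add[symmetric] integrable_L2_test F test_functions_wirtinger AB)
  also have "\<dots> = - 4 * (LINT z|diskM. F z * wgt_op \<phi> z)"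
    unfolding * by simp
  finally show ?thesis .
qed

section \<open>Passage from test functions to smooth functions on the plane\<close>

lemma cutoff_bounded:
  obtains B where "\<And>e z. 0 < e \<Longrightarrow> cmod (cutoff e p z) \<le> B"
proof -
  obtain B where B: "\<And>x::real. x \<ge> 0 \<Longrightarrow> \<bar>poly p x * exp (- x)\<bar> \<le> B"
    using poly_times_exp_neg_bounded by blast
  have "\<bar>flat_exp p t\<bar> \<le> B" for t
    using B[of "1 / t"] order_trans[OF abs_ge_zero B[of 0]] by (auto simp: flat_exp_def)
  then show ?thesis
    by (auto intro!: that[of B] simp: cutoff_def)
qed

text \<open>At a fixed point of the disk and for small e, the cutoff is p(x) exp (- x) with x = e /
  (1 - e - |z|^2), and x tends to 0. So only the constant term of p survives.\<close>

lemma cutoff_tendsto: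
  assumes e: "e \<longlonglongrightarrow> 0" "\<And>n. 0 < e n" and z: "z \<in> disk"
  shows "(\<lambda>n. cutoff (e n) p z) \<longlonglongrightarrow> of_real (poly p 0)"
proof -
  define s where "s = (cmod z)\<^sup>2"
  have s: "s < 1"
    using z by (simp add: s_def abs_square_less_1)
  have "(\<lambda>n. e n / (1 - e n - s)) \<longlonglongrightarrow> 0 / (1 - 0 - s)"
    using s by (intro tendsto_intros e) auto
  then have x: "(\<lambda>n. e n / (1 - e n - s)) \<longlonglongrightarrow> 0"
    by simp
  have "(\<lambda>n. poly p (e n / (1 - e n - s)) * exp (- (e n / (1 - e n - s)))) \<longlonglongrightarrow> poly p 0 * exp (- 0)"
    by (intro tendsto_intros x isCont_tendsto_compose[OF poly_isCont])
  moreover have "\<forall>\<^sub>F n in sequentially. poly p (e n / (1 - e n - s)) * exp (- (e n / (1 - e n - s))) =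
      flat_exp p ((1 - e n - s) / e n)"
  proof -
    have "\<forall>\<^sub>F n in sequentially. e n < 1 - s"
      using s by (intro order_tendstoD[OF e(1)]) auto
    then show ?thesis
      by eventually_elim (use e(2) in \<open>simp add: flat_exp_def\<close>)
  qed
  ultimately have "(\<lambda>n. flat_exp p ((1 - e n - s) / e n)) \<longlonglongrightarrow> poly p 0"
    by (simp add: Lim_transform_eventually)
  then show ?thesis
    unfolding cutoff_def s_def by (intro tendsto_of_real)
qed

text \<open>Each derivative of the cutoff costs a factor \<open>1 / e\<close>, and the weight \<open>1 - |z|\<^sup>2\<close> compensates it
  uniformly, since it equals \<open>e * (1 + 1 / x)\<close> for \<open>x = e / (1 - e - |z|\<^sup>2)\<close>.\<close>

lemma wgt_cutoff_deriv:
  assumes "0 < e"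
  shows "wgt z * of_real (- 1 / e) * cutoff e (flat_deriv 1) z = cutoff e [:0, -1, -1:] z"
    and "(wgt z * of_real (- 1 / e))\<^sup>2 * cutoff e (flat_deriv (flat_deriv 1)) z =
      cutoff e ([:1, 1:]\<^sup>2 * [:0, -2, 1:]) z"
proof -
  define t where "t = (1 - e - (cmod z)\<^sup>2) / e"
  have w: "wgt z * of_real (- 1 / e) = of_real (- (1 + t))"
    using assms by (simp add: wgt_eq_of_real t_def field_simps)
  have p1: "flat_deriv 1 = [:0, 0, 1:]"
    by (simp add: flat_deriv_def pderiv_1)
  have p2: "flat_deriv [:0, 0, 1:] = [:0, 0, 0, -2, 1:]"
    by (simp add: flat_deriv_def pderiv_pCons)
  have "- (1 + t) * flat_exp [:0, 0, 1:] t = flat_exp [:0, -1, -1:] t"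
    by (simp add: flat_exp_def field_simps)
  then show "wgt z * of_real (- 1 / e) * cutoff e (flat_deriv 1) z = cutoff e [:0, -1, -1:] z"
    unfolding w cutoff_def p1 t_def[symmetric] by (simp only: flip: of_real_mult)
  have "(- (1 + t))\<^sup>2 * flat_exp [:0, 0, 0, -2, 1:] t = flat_exp ([:1, 1:]\<^sup>2 * [:0, -2, 1:]) t"
    by (simp add: flat_exp_def field_simps power2_eq_square)
  then show "(wgt z * of_real (- 1 / e))\<^sup>2 * cutoff e (flat_deriv (flat_deriv 1)) z =
      cutoff e ([:1, 1:]\<^sup>2 * [:0, -2, 1:]) z"
    unfolding w cutoff_def p1 p2 t_def[symmetric] by (simp only: flip: of_real_mult of_real_power)
qed

text \<open>Test with \<open>q\<close> times a cutoff and let the cutoff tend to 1. Each derivative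
  of the cutoff comes with one factor of the weight, so the extra terms are bounded uniformly in e
  and tend to 0 pointwise; dominated convergence with a multiple of |F| removes them.\<close>

lemma integral_wgt_op_smooth_eq_0:
  assumes F: "F \<in> L2_disk"
    and weak: "\<And>\<phi>. \<phi> \<in> test_functions \<Longrightarrow> (LINT z|diskM. F z * wgt_op \<phi> z) = 0"
    and q: "\<And>k. C_k k q"
  shows "(LINT z|diskM. F z * wgt_op q z) = 0"
proof -
  define e where "e n = 1 / (real n + 2)" for n
  have e: "0 < e n" "e n < 1" for n
    by (auto simp: e_def)
  have e0: "e \<longlonglongrightarrow> 0"
    unfolding e_def by real_asymp
  define q1 where "q1 = wirtinger q"
  define q2 where "q2 = wirtinger_bar q"
  define q12 where "q12 = wirtinger_bar q1"
  have qk: "C_k k q1" "C_k k q2" "C_k k q12" for k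
    unfolding q1_def q2_def q12_def by (intro C_k_wirtinger q)+
  have wq: "has_wirt q (q1 z) (q2 z) z" "has_wirt q1 (wirtinger q1 z) (q12 z) z" for z
    unfolding q1_def q2_def q12_def by (intro differentiable_has_wirt C_k_differentiable C_k_wirtinger q)+
  \<comment> \<open>\<open>E1\<close> and \<open>E2\<close> collect what accompanies the first and
    the second derivative of the cutoff in \<open>wgt_op (\<psi> n)\<close>.\<close>
  define E1 where "E1 z = - 2 * z * cnj z * q z + wgt z * (q z + cnj z * q2 z + z * q1 z)" for z
  define E2 where "E2 z = z * cnj z * q z" for z
  define \<psi> where "\<psi> n z = cutoff (e n) 1 z * q z" for n z
  have \<psi>: "\<psi> n \<in> test_functions" for n
    unfolding \<psi>_def by (rule cutoff_test_function[OF e q])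
  \<comment> \<open>With x = 1 / t these are - x^2 (1 + 1 / x) and (x^4 - 2 x^3) (1 + 1 / x)^2, the
    effect of one and two weights on the first two derivatives. Neither has a constant term, so both
    cutoffs tend to 0.\<close>
  define R1 where "R1 = [:0, -1, -1::real:]"
  define R2 where "R2 = [:1, 1:]\<^sup>2 * [:0, -2, 1::real:]"
  define I where "I n z = cutoff (e n) 1 z * wgt_op q z + cutoff (e n) R1 z * E1 z + cutoff (e n) R2 z * E2 z" for n z
  have op: "wgt_op (\<psi> n) z = I n z" for n z
  proof -
    define \<alpha> where "\<alpha> = complex_of_real (- 1 / e n)"
    define c where "c j = cutoff (e n) ((flat_deriv ^^ j) 1)" for j
    have c: "has_wirt (c j) (\<alpha> * (c (Suc j) z * cnj z)) (\<alpha> * (c (Suc j) z * z)) z" for j z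
      unfolding c_def \<alpha>_def using has_wirt_cutoff[of "e n"] e(1)[of n] by simp
    have w1: "wirtinger (\<psi> n) = (\<lambda>z. \<alpha> * (c 1 z * cnj z) * q z + c 0 z * q1 z)"
      using has_wirtD(1)[OF has_wirt_mult[OF c[of 0] wq(1)]] by (simp add: fun_eq_iff \<psi>_def[abs_def] c_def)
    have "has_wirt (\<lambda>z. (wgt z)\<^sup>2 * (\<alpha> * (c 1 z * cnj z) * q z + c 0 z * q1 z))
       (- 2 * wgt z * cnj z * (\<alpha> * (c 1 z * cnj z) * q z + c 0 z * q1 z) + (wgt z)\<^sup>2 *
         ((\<alpha> * (\<alpha> * (c (Suc 1) z * cnj z) * cnj z + c 1 z * 0)) * q z + \<alpha> * (c 1 z * cnj z) * q1 z +
          (\<alpha> * (c (Suc 0) z * cnj z) * q1 z + c 0 z * wirtinger q1 z)))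
       (- 2 * wgt z * z * (\<alpha> * (c 1 z * cnj z) * q z + c 0 z * q1 z) + (wgt z)\<^sup>2 *
         ((\<alpha> * (\<alpha> * (c (Suc 1) z * z) * cnj z + c 1 z * 1)) * q z + \<alpha> * (c 1 z * cnj z) * q2 z +
          (\<alpha> * (c (Suc 0) z * z) * q1 z + c 0 z * q12 z))) z"
      by (intro has_wirt_mult has_wirt_add has_wirt_wgt_sq has_wirt_cmult c has_wirt_cnj wq)
    then have "wgt_op (\<psi> n) z =
      - 2 * wgt z * z * (\<alpha> * (c 1 z * cnj z) * q z + c 0 z * q1 z) + (wgt z)\<^sup>2 *
         ((\<alpha> * (\<alpha> * (c (Suc 1) z * z) * cnj z + c 1 z * 1)) * q z + \<alpha> * (c 1 z * cnj z) * q2 z +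
          (\<alpha> * (c (Suc 0) z * z) * q1 z + c 0 z * q12 z))"
      unfolding wgt_op_def w1 by (rule has_wirtD(2))
    also have "\<dots> = c 0 z * (- 2 * wgt z * z * q1 z + (wgt z)\<^sup>2 * q12 z) + (wgt z * \<alpha> * c 1 z) * E1 z
        + ((wgt z * \<alpha>)\<^sup>2 * c 2 z) * E2 z"
      unfolding E1_def E2_def numeral_2_eq_2 One_nat_def power2_eq_square by (simp add: algebra_simps)
    also have "- 2 * wgt z * z * q1 z + (wgt z)\<^sup>2 * q12 z = wgt_op q z"
      unfolding q1_def q12_def by (rule wgt_op_eq[OF q, symmetric])
    also have "wgt z * \<alpha> * c 1 z = cutoff (e n) R1 z"
      using wgt_cutoff_deriv(1)[OF e(1)] by (simp add: \<alpha>_def c_def R1_def)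
    also have "(wgt z * \<alpha>)\<^sup>2 * c 2 z = cutoff (e n) R2 z"
      using wgt_cutoff_deriv(2)[OF e(1)] by (simp add: \<alpha>_def c_def R2_def numeral_2_eq_2)
    finally show ?thesis
      by (simp add: I_def c_def)
  qed
  have cont: "continuous_on S (wgt_op q)" "continuous_on S E1" "continuous_on S E2" for S
  proof -
    have "continuous_on UNIV (wgt_op q)"
      unfolding wgt_op_def
      by (rule C_k_continuous[of 0], intro C_k_wirtinger C_k_mult C_k_power C_k_zpoly zpoly_wgt q)
    then show "continuous_on S (wgt_op q)"
      by (rule continuous_on_subset) auto
    show "continuous_on S E1" "continuous_on S E2"
      unfolding E1_def[abs_def] E2_def[abs_def]
      by (intro continuous_intros continuous_on_zpoly[OF zpoly_wgt]
          continuous_on_subset[OF C_k_continuous[OF q]] continuous_on_subset[OF C_k_continuous[OF qk(1)]]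
          continuous_on_subset[OF C_k_continuous[OF qk(2)]] subset_UNIV)+
  qed
  obtain K0 where K0: "\<And>z. cmod z \<le> 1 \<Longrightarrow> cmod (wgt_op q z) \<le> K0"
    using continuous_cball_bounded[OF cont(1)] by blast
  obtain K1 where K1: "\<And>z. cmod z \<le> 1 \<Longrightarrow> cmod (E1 z) \<le> K1"
    using continuous_cball_bounded[OF cont(2)] by blast
  obtain K2 where K2: "\<And>z. cmod z \<le> 1 \<Longrightarrow> cmod (E2 z) \<le> K2"
    using continuous_cball_bounded[OF cont(3)] by blast
  obtain B0 where B0: "\<And>e z. 0 < e \<Longrightarrow> cmod (cutoff e 1 z) \<le> B0"
    using cutoff_bounded by blast
  obtain B1 where B1: "\<And>e z. 0 < e \<Longrightarrow> cmod (cutoff e R1 z) \<le> B1"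
    using cutoff_bounded by blast
  obtain B2 where B2: "\<And>e z. 0 < e \<Longrightarrow> cmod (cutoff e R2 z) \<le> B2"
    using cutoff_bounded by blast
  define C where "C = B0 * K0 + B1 * K1 + B2 * K2"
  have "(\<lambda>n. LINT z|diskM. F z * wgt_op (\<psi> n) z) \<longlonglongrightarrow> (LINT z|diskM. F z * wgt_op q z)"
  proof (rule integral_dominated_convergence)
    show "integrable diskM (\<lambda>z. cmod (F z) * C)"
      using L2_diskD(3)[OF F] by simp
    show "AE z in diskM. (\<lambda>n. F z * wgt_op (\<psi> n) z) \<longlonglongrightarrow> F z * wgt_op q z"
    proof (rule AE_I2)
      fix z assume "z \<in> space diskM"
      then have z: "z \<in> disk" by simp
      have "(\<lambda>n. F z * wgt_op (\<psi> n) z) \<longlonglongrightarrow> F z * (of_real (poly 1 0) * wgt_op q z +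
          of_real (poly R1 0) * E1 z + of_real (poly R2 0) * E2 z)"
        unfolding op I_def by (intro tendsto_intros cutoff_tendsto e0 e z)
      then show "(\<lambda>n. F z * wgt_op (\<psi> n) z) \<longlonglongrightarrow> F z * wgt_op q z"
        by (simp add: R1_def R2_def)
    qed
    show "AE z in diskM. cmod (F z * wgt_op (\<psi> n) z) \<le> cmod (F z) * C" for n
    proof (rule AE_I2)
      fix z assume "z \<in> space diskM"
      then have z: "cmod z \<le> 1" by simp
      have "cmod (wgt_op (\<psi> n) z) \<le> cmod (cutoff (e n) 1 z) * cmod (wgt_op q z) +
          cmod (cutoff (e n) R1 z) * cmod (E1 z) + cmod (cutoff (e n) R2 z) * cmod (E2 z)"
        unfolding op I_def by (intro norm_triangle_le add_mono) (simp_all add: norm_mult)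
      also have "\<dots> \<le> C"
        unfolding C_def
        by (intro add_mono mult_mono B0 B1 B2 K0 K1 K2 e z norm_ge_zero
            order_trans[OF norm_ge_zero B0[OF e(1)]] order_trans[OF norm_ge_zero B1[OF e(1)]]
            order_trans[OF norm_ge_zero B2[OF e(1)]])
      finally show "cmod (F z * wgt_op (\<psi> n) z) \<le> cmod (F z) * C"
        by (simp add: norm_mult mult_left_mono)
    qed
    show "(\<lambda>z. F z * wgt_op (\<psi> n) z) \<in> borel_measurable diskM" for n
      using integrable_L2_test[OF F wgt_op_test[OF \<psi>]] by (rule borel_measurable_integrable)
    show "(\<lambda>z. F z * wgt_op q z) \<in> borel_measurable diskM"
      using L2_diskD(1)[OF F] measurable_diskM_continuous[OF cont(1)] by measurable
  qed
  then show ?thesis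
    by (simp add: weak[OF \<psi>] LIMSEQ_const_iff)
qed

definition wmom :: "(complex \<Rightarrow> complex) \<Rightarrow> nat \<Rightarrow> nat \<Rightarrow> complex" where
  "wmom F a b = (LINT z|diskM. wgt z * F z * (z ^ a * cnj z ^ b))"

lemma integrable_mult_zpoly: "F \<in> L2_disk \<Longrightarrow> zpoly p \<Longrightarrow> integrable diskM (\<lambda>z. F z * p z)"
  by (intro L2_diskD(3) L2_disk_mult_continuous continuous_on_zpoly)

text \<open>Test with z ^ Suc a * cnj z ^ b. Expanding one of the two weights of the second-order
  term as 1 - z cnj z merges part of it with the first-order term and turns the coefficient 2 into b
  + 2. The exponent of z has to be positive because d/dz kills powers of cnj z; this is why the
  moments \<open>wmom F 0 d\<close> stay free.\<close>

lemma wmom_recursion: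
  assumes F: "F \<in> L2_disk"
    and weak: "\<And>\<phi>. \<phi> \<in> test_functions \<Longrightarrow> (LINT z|diskM. F z * wgt_op \<phi> z) = 0"
  shows "of_nat (b + 2) * wmom F (Suc a) b = of_nat b * wmom F a (b - 1)"
proof -
  define q where "q = (\<lambda>z. z ^ Suc a * cnj z ^ b)"
  have qk: "C_k k q" for k
    unfolding q_def by (intro C_k_zpoly zpoly_mon)
  have q1: "wirtinger q = (\<lambda>z. of_nat (Suc a) * (z ^ a * cnj z ^ b))"
    unfolding q_def by (rule ext) (simp add: has_wirtD(1)[OF has_wirt_mon] del: power_Suc of_nat_Suc)
  have q12: "wirtinger_bar (wirtinger q) z = of_nat (Suc a) * (of_nat b * z ^ a * cnj z ^ (b - 1))" for z
    unfolding q1 by (rule has_wirtD(2)[OF has_wirt_cmult[OF has_wirt_mon]])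
  have op: "wgt_op q z = of_nat (Suc a) * (of_nat b * (wgt z * (z ^ a * cnj z ^ (b - 1)))
      - of_nat (b + 2) * (wgt z * (z ^ Suc a * cnj z ^ b)))" for z
  proof -
    have "of_nat b * (wgt z * (z ^ a * cnj z ^ (b - 1))) - of_nat (b + 2) * (wgt z * (z ^ Suc a * cnj z ^ b)) =
        wgt z * (- 2 * z * (z ^ a * cnj z ^ b) + wgt z * (of_nat b * z ^ a * cnj z ^ (b - 1)))"
      \<comment> \<open>For b = 0 the exponent b - 1 is truncated to 0, but its coefficient
        vanishes.\<close>
      by (cases b) (simp_all add: wgt_def algebra_simps)
    moreover have "wgt_op q z = - 2 * wgt z * z * (of_nat (Suc a) * (z ^ a * cnj z ^ b)) +
        (wgt z)\<^sup>2 * (of_nat (Suc a) * (of_nat b * z ^ a * cnj z ^ (b - 1)))"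
      using wgt_op_eq[OF qk, of z] unfolding q12 unfolding q1 .
    moreover have "\<dots> = of_nat (Suc a) * (wgt z * (- 2 * z * (z ^ a * cnj z ^ b) +
        wgt z * (of_nat b * z ^ a * cnj z ^ (b - 1))))"
      by (simp add: power2_eq_square algebra_simps del: of_nat_Suc)
    ultimately show ?thesis
      by (simp only:)
  qed
  have eq: "F z * wgt_op q z = of_nat (Suc a) * (of_nat b * (wgt z * F z * (z ^ a * cnj z ^ (b - 1)))
      - of_nat (b + 2) * (wgt z * F z * (z ^ Suc a * cnj z ^ b)))" for z
    unfolding op by (simp add: algebra_simps)
  have i: "integrable diskM (\<lambda>z. wgt z * F z * (z ^ a * cnj z ^ b))" for a b
    using integrable_mult_zpoly[OF F zpoly_mult[OF zpoly_wgt zpoly_mon]] by (simp add: mult_ac)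
  have "0 = (LINT z|diskM. F z * wgt_op q z)"
    by (rule integral_wgt_op_smooth_eq_0[OF F weak qk, symmetric])
  also have "\<dots> = of_nat (Suc a) * (of_nat b * wmom F a (b - 1) - of_nat (b + 2) * wmom F (Suc a) b)"
    unfolding eq wmom_def using i[of a "b - 1"] i[of "Suc a" b] by (simp del: power_Suc of_nat_Suc of_nat_add)
  finally show ?thesis
    by (simp del: of_nat_Suc of_nat_add)
qed

section \<open>Moments of null solutions\<close>

definition weak_null :: "(complex \<Rightarrow> complex) \<Rightarrow> bool" where
  "weak_null F \<longleftrightarrow> F \<in> L2_disk \<and> (\<forall>\<phi>\<in>test_functions. (LINT z|diskM. F z * wgt_op \<phi> z) = 0)"

lemma weak_null_L2: "weak_null F \<Longrightarrow> F \<in> L2_disk"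
  by (simp add: weak_null_def)

lemma weak_null_recursion:
  "weak_null F \<Longrightarrow> of_nat (b + 2) * wmom F (Suc a) b = of_nat b * wmom F a (b - 1)"
  by (rule wmom_recursion) (auto simp: weak_null_def)

lemma integral_holomorphic_wirtinger_bar:
  assumes "f holomorphic_on disk" "\<phi> \<in> test_functions"
  shows "(LINT z|diskM. f z * wirtinger_bar \<phi> z) = 0"
    and "(LINT z|diskM. f z * wirtinger \<phi> z) = - (LINT z|diskM. deriv f z * \<phi> z)"
proof -
  have w: "has_wirt f (deriv f z) 0 z" if "z \<in> disk" for z
    by (rule has_wirt_holomorphic[OF assms(1) open_ball that])
  have c: "continuous_on disk (deriv f)"
    using assms(1) by (intro holomorphic_on_imp_continuous_on holomorphic_deriv) auto
  show "(LINT z|diskM. f z * wirtinger_bar \<phi> z) = 0"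
    using integral_by_parts_disk(2)[OF w c continuous_on_const assms(2)] by simp
  show "(LINT z|diskM. f z * wirtinger \<phi> z) = - (LINT z|diskM. deriv f z * \<phi> z)"
    using integral_by_parts_disk(1)[OF w c continuous_on_const assms(2)] by simp
qed

lemma wgt_sq_wirtinger_test:
  "\<phi> \<in> test_functions \<Longrightarrow> (\<lambda>z. (wgt z)\<^sup>2 * wirtinger \<phi> z) \<in> test_functions"
  by (intro test_functions_mult test_functions_wirtinger C_k_power C_k_zpoly zpoly_wgt)

lemma weak_null_holomorphic:
  assumes "f holomorphic_on disk" "f \<in> L2_disk"
  shows "weak_null f"
  unfolding weak_null_def wgt_op_def
  using integral_holomorphic_wirtinger_bar(1)[OF assms(1) wgt_sq_wirtinger_test] assms(2) by blast

lemma weak_null_one: "weak_null (\<lambda>_. 1)"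
  by (intro weak_null_holomorphic L2_disk_zpoly zpoly_const holomorphic_intros)

text \<open>The recursion lowers both exponents by one. For b < a this ends at b = 0 with a positive
  exponent of z, where the right-hand side has the factor 0.\<close>

lemma wmom_above:
  assumes "weak_null F"
  shows "b < a \<Longrightarrow> wmom F a b = 0"
proof (induction b arbitrary: a)
  case 0
  then obtain a' where "a = Suc a'" by (cases a) auto
  then show ?case
    using weak_null_recursion[OF assms, of 0 a'] by simp
next
  case (Suc b)
  then obtain a' where a: "a = Suc a'" "b < a'" by (cases a) auto
  have "of_nat (Suc b + 2) * wmom F (Suc a') (Suc b) = 0"
    using weak_null_recursion[OF assms, of "Suc b" a'] Suc.IH[OF a(2)] by simp
  then show ?case
    unfolding a mult_eq_0_iff of_nat_eq_0_iff by simp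
qed

text \<open>The factors b / (b + 2) of the recursion for b = d + 1, ..., d + a telescope; the
  denominators are cleared here.\<close>

lemma wmom_diagonal:
  assumes "weak_null F"
  shows "of_nat ((d + a + 1) * (d + a + 2)) * wmom F a (d + a) = of_nat ((d + 1) * (d + 2)) * wmom F 0 d"
proof (induction a)
  case (Suc a)
  have "of_nat ((d + Suc a + 1) * (d + Suc a + 2)) * wmom F (Suc a) (d + Suc a) =
      of_nat (d + a + 2) * (of_nat (Suc (d + a) + 2) * wmom F (Suc a) (Suc (d + a)))"
    by (simp add: algebra_simps)
  also have "\<dots> = of_nat ((d + a + 1) * (d + a + 2)) * wmom F a (d + a)"
    unfolding weak_null_recursion[OF assms] by (simp add: algebra_simps)
  finally show ?case
    using Suc.IH by simp
qed simp

text \<open>The weight is positive on a set of positive measure. The number normalises the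
  coefficients of the power series, and its exact value is never computed.\<close>

lemma wmom_one_0_0: "wmom (\<lambda>_. 1) 0 0 \<noteq> 0"
proof
  assume "wmom (\<lambda>_. 1) 0 0 = 0"
  moreover have i: "integrable diskM (\<lambda>z. 1 - (cmod z)\<^sup>2)"
    using integrable_Re[OF L2_diskD(3)[OF L2_disk_zpoly[OF zpoly_wgt]]] by (simp add: wgt_eq_of_real)
  then have "wmom (\<lambda>_. 1) 0 0 = of_real (LINT z|diskM. 1 - (cmod z)\<^sup>2)"
    by (simp add: wmom_def wgt_eq_of_real del: of_real_diff)
  ultimately have "(LINT z|diskM. 1 - (cmod z)\<^sup>2) = 0"
    by simp
  moreover have pos: "0 < 1 - (cmod z)\<^sup>2" if "z \<in> space diskM" for z
    using that by (simp add: abs_square_less_1)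
  ultimately have "AE z in diskM. 1 - (cmod z)\<^sup>2 = 0"
    by (subst (asm) integral_nonneg_eq_0_iff_AE[OF i]) (auto intro!: AE_I2 less_imp_le)
  then have "AE z in diskM. False"
    by (rule AE_mp) (use pos in \<open>force intro!: AE_I2\<close>)
  then have "emeasure diskM (space diskM) = 0"
    by (subst (asm) AE_iff_measurable[of "space diskM"]) auto
  then have "measure lebesgue disk = 0"
    by (simp add: emeasure_restrict_space measure_def)
  moreover have "0 < measure lebesgue disk"
    using content_ball_pos[of 1 "0::complex"] by simp
  ultimately show False
    by simp
qed

text \<open>The constant 1 is itself a null solution, so the recursion evaluates the moments of the
  weight without polar coordinates. For a < b, conjugation exchanges the exponents.\<close>

lemma wmom_one:
  "of_nat ((b + 1) * (b + 2)) * wmom (\<lambda>_. 1) a b = (if a = b then 2 * wmom (\<lambda>_. 1) 0 0 else 0)"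
proof (cases a b rule: linorder_cases)
  case less
  have "wmom (\<lambda>_. 1) a b = (LINT z|diskM. cnj (wgt z * 1 * (z ^ b * cnj z ^ a)))"
    unfolding wmom_def by (intro Bochner_Integration.integral_cong) (auto simp: wgt_def)
  also have "\<dots> = cnj (wmom (\<lambda>_. 1) b a)"
    unfolding wmom_def by (rule Bochner_Integration.integral_cnj)
  finally show ?thesis
    using wmom_above[OF weak_null_one less] less by simp
next
  case equal
  then show ?thesis
    using wmom_diagonal[OF weak_null_one, of 0 b] by (simp del: of_nat_mult of_nat_add)
next
  case greater
  then show ?thesis
    using wmom_above[OF weak_null_one greater] by simp
qed

text \<open>Multiplication by 1 - r is summation by parts: it lowers the degree of the coefficients
  by one and leaves a nonpositive boundary term, which is dropped. Three rounds give the value of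
  the full series as a bound.\<close>

lemma quadratic_geometric_sum_le:
  fixes r :: real
  assumes "0 \<le> r" "r < 1"
  shows "(\<Sum>k<n. (real k + 1) * (real k + 2) * r ^ k) \<le> 2 / (1 - r) ^ 3"
proof -
  have 1: "(1 - r) * (\<Sum>k<n. r ^ k) = 1 - r ^ n"
    by (rule one_diff_power_eq[symmetric])
  have 2: "(1 - r) * (\<Sum>k<n. (real k + 1) * r ^ k) = (\<Sum>k<n. r ^ k) - real n * r ^ n"
  proof (induction n)
    case (Suc n)
    show ?case
      unfolding sum.lessThan_Suc distrib_left[of "1 - r"] Suc.IH by (simp add: algebra_simps)
  qed simp
  have 3: "(1 - r) * (\<Sum>k<n. (real k + 1) * (real k + 2) * r ^ k) =
      2 * (\<Sum>k<n. (real k + 1) * r ^ k) - real n * (real n + 1) * r ^ n"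
  proof (induction n)
    case (Suc n)
    show ?case
      unfolding sum.lessThan_Suc distrib_left[of "1 - r"] Suc.IH by (simp add: algebra_simps)
  qed simp
  have "(1 - r) ^ 3 * (\<Sum>k<n. (real k + 1) * (real k + 2) * r ^ k) =
      (1 - r)\<^sup>2 * ((1 - r) * (\<Sum>k<n. (real k + 1) * (real k + 2) * r ^ k))"
    by (simp add: power2_eq_square power3_eq_cube)
  also have "\<dots> \<le> (1 - r)\<^sup>2 * (2 * (\<Sum>k<n. (real k + 1) * r ^ k))"
    unfolding 3 using assms by (intro mult_left_mono) auto
  also have "\<dots> = (1 - r) * (2 * ((1 - r) * (\<Sum>k<n. (real k + 1) * r ^ k)))"
    by (simp add: power2_eq_square)
  also have "\<dots> \<le> (1 - r) * (2 * (\<Sum>k<n. r ^ k))"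
    unfolding 2 using assms by (intro mult_left_mono) auto
  also have "\<dots> = 2 * ((1 - r) * (\<Sum>k<n. r ^ k))"
    by simp
  also have "\<dots> \<le> 2"
    unfolding 1 using assms by simp
  finally show ?thesis
    using assms by (simp add: field_simps)
qed

text \<open>The moments of \<open>(1 - |z|\<^sup>2) F\<close> obey the same recursion as those of \<open>(1 - |z|\<^sup>2) z\<^sup>d\<close>, so they
  are the moments of a power series. Its coefficients grow at most quadratically, so a higher power of
  the weight makes it bounded.\<close>

lemma weak_null_imp_holomorphic:
  assumes F: "weak_null F"
  shows "\<exists>f. f holomorphic_on disk \<and> (AE z in diskM. F z = f z)"
proof -
  note FL = weak_null_L2[OF F]
  define m where "m = 2 * wmom (\<lambda>_. 1) 0 0"
  have m: "m \<noteq> 0"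
    using wmom_one_0_0 by (simp add: m_def)
  \<comment> \<open>The moment of 1 at (d, d) is m / ((d + 1) (d + 2)), so with this coefficient
    \<open>c d * z ^ d\<close> and \<open>F\<close> have the same weighted moment against cnj z ^
    d.\<close>
  define c where "c d = of_nat ((d + 1) * (d + 2)) * wmom F 0 d / m" for d
  define J where "J = (LINT z|diskM. cmod (F z))"
  have wF: "integrable diskM (\<lambda>z. wgt z * F z * p z)" if "zpoly p" for p
    using integrable_mult_zpoly[OF FL zpoly_mult[OF zpoly_wgt that]] by (simp add: mult_ac)
  have w1: "integrable diskM (\<lambda>z. wgt z * z ^ d * p z)" if "zpoly p" for p d
    by (intro L2_diskD(3) L2_disk_zpoly zpoly_mult zpoly_wgt zpoly_power zpoly_ident that)
  have wgt_norm: "cmod (wgt z) = 1 - (cmod z)\<^sup>2" "0 < 1 - (cmod z)\<^sup>2" "cmod (wgt z) \<le> 1" if "z \<in> disk" for z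
    using that by (auto simp: wgt_eq_of_real abs_square_less_1 abs_of_pos simp del: of_real_diff)
  have J: "cmod (wmom F 0 d) \<le> J" for d
    unfolding wmom_def J_def
  proof (rule Bochner_Integration.integral_norm_bound_integral)
    show "integrable diskM (\<lambda>z. wgt z * F z * (z ^ 0 * cnj z ^ d))"
      by (intro wF zpoly_mon)
    show "integrable diskM (\<lambda>z. cmod (F z))"
      using L2_diskD(3)[OF FL] by simp
    fix z assume "z \<in> space diskM"
    then have z: "z \<in> disk" by simp
    have "cmod (wgt z) * cmod z ^ d \<le> 1 * 1"
      using z by (intro mult_mono wgt_norm(3) power_le_one) auto
    then have "cmod (F z) * (cmod (wgt z) * cmod z ^ d) \<le> cmod (F z) * 1"
      by (intro mult_left_mono) auto
    then show "cmod (wgt z * F z * (z ^ 0 * cnj z ^ d)) \<le> cmod (F z)"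
      by (simp add: norm_mult norm_power mult_ac)
  qed
  define K where "K = J / cmod m"
  have K0: "0 \<le> K"
    by (simp add: K_def J_def)
  have cK: "cmod (c d) \<le> K * ((real d + 1) * (real d + 2))" for d
  proof -
    have "cmod (c d) = cmod (wmom F 0 d) / cmod m * ((real d + 1) * (real d + 2))"
      using m unfolding c_def norm_divide norm_mult norm_of_nat by (simp add: field_simps)
    also have "\<dots> \<le> K * ((real d + 1) * (real d + 2))"
      unfolding K_def by (intro mult_right_mono divide_right_mono J) auto
    finally show ?thesis .
  qed
  \<comment> \<open>The moments of 1 vanish off the diagonal, so only the term d = b - a can survive
    and convergence is no issue; for a > b both sides are 0.\<close>
  have cmom: "(\<lambda>d. c d * wmom (\<lambda>_. 1) (a + d) b) sums wmom F a b" for a b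
  proof (cases "a \<le> b")
    case True
    have "c d * wmom (\<lambda>_. 1) (a + d) b = (if d = b - a then wmom F a b else 0)" for d
    proof (cases "d = b - a")
      case d: True
      then have b: "b = d + a"
        using True by simp
      have "of_nat ((b + 1) * (b + 2)) * (c d * wmom (\<lambda>_. 1) (a + d) b) =
          c d * (of_nat ((b + 1) * (b + 2)) * wmom (\<lambda>_. 1) (a + d) b)"
        by (rule mult.left_commute)
      also have "\<dots> = c d * m"
        unfolding wmom_one by (simp add: b m_def)
      also have "\<dots> = of_nat ((d + 1) * (d + 2)) * wmom F 0 d"
        using m by (simp add: c_def del: of_nat_mult of_nat_add)
      also have "\<dots> = of_nat ((b + 1) * (b + 2)) * wmom F a b"
        unfolding b by (rule wmom_diagonal[OF F, symmetric])
      finally show ?thesis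
        using d unfolding mult_cancel_left of_nat_eq_0_iff by simp
    next
      case False
      then have "of_nat ((b + 1) * (b + 2)) * wmom (\<lambda>_. 1) (a + d) b = 0"
        using wmom_one[of b "a + d"] True by auto
      then have "wmom (\<lambda>_. 1) (a + d) b = 0"
        unfolding mult_eq_0_iff of_nat_eq_0_iff by simp
      then show ?thesis
        using False by simp
    qed
    then show ?thesis
      using sums_single[of "b - a" "\<lambda>_. wmom F a b"] by simp
  next
    case False
    then show ?thesis
      using wmom_above[OF F] wmom_above[OF weak_null_one] by simp
  qed
  have cp: "(\<lambda>d. c d * (LINT z|diskM. wgt z * z ^ d * p z)) sums (LINT z|diskM. wgt z * F z * p z)"
    if "zpoly p" for p
    using that
  proof induction
    case (step p e j k)
    have "(LINT z|diskM. wgt z * z ^ d * (p z + e * (z ^ j * cnj z ^ k))) =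
        (LINT z|diskM. wgt z * z ^ d * p z) + e * wmom (\<lambda>_. 1) (j + d) k" for d
    proof -
      have "(LINT z|diskM. wgt z * z ^ d * (p z + e * (z ^ j * cnj z ^ k))) =
          (LINT z|diskM. wgt z * z ^ d * p z + e * (wgt z * z ^ d * (z ^ j * cnj z ^ k)))"
        by (simp add: algebra_simps)
      also have "\<dots> = (LINT z|diskM. wgt z * z ^ d * p z) + e * (LINT z|diskM. wgt z * z ^ d * (z ^ j * cnj z ^ k))"
        using w1[OF step.hyps, of d] w1[OF zpoly_mon, of d j k] by simp
      also have "(LINT z|diskM. wgt z * z ^ d * (z ^ j * cnj z ^ k)) = wmom (\<lambda>_. 1) (j + d) k"
        by (simp add: wmom_def power_add mult_ac)
      finally show ?thesis .
    qed
    moreover have "(LINT z|diskM. wgt z * F z * (p z + e * (z ^ j * cnj z ^ k))) =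
        (LINT z|diskM. wgt z * F z * p z) + e * wmom F j k"
    proof -
      have "(LINT z|diskM. wgt z * F z * (p z + e * (z ^ j * cnj z ^ k))) =
          (LINT z|diskM. wgt z * F z * p z + e * (wgt z * F z * (z ^ j * cnj z ^ k)))"
        by (simp add: algebra_simps)
      then show ?thesis
        using wF[OF step.hyps] wF[OF zpoly_mon, of j k] by (simp add: wmom_def)
    qed
    moreover have "(\<lambda>d. c d * (LINT z|diskM. wgt z * z ^ d * p z) + e * (c d * wmom (\<lambda>_. 1) (j + d) k)) sums
        ((LINT z|diskM. wgt z * F z * p z) + e * wmom F j k)"
      by (intro sums_add step.IH sums_mult cmom)
    ultimately show ?case
      by (simp add: algebra_simps)
  qed simp
  define S where "S n z = (\<Sum>d<n. c d * z ^ d)" for n z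
  define f where "f z = (\<Sum>d. c d * z ^ d)" for z
  have le: "(\<Sum>d<n. cmod (c d * z ^ d)) \<le> K * (2 / (1 - cmod z) ^ 3)" if "z \<in> disk" for n z
  proof -
    have "(\<Sum>d<n. cmod (c d * z ^ d)) \<le> (\<Sum>d<n. K * ((real d + 1) * (real d + 2) * cmod z ^ d))"
      using mult_right_mono[OF cK zero_le_power[OF norm_ge_zero[of z]]]
      by (intro sum_mono) (simp add: norm_mult norm_power mult_ac)
    also have "\<dots> = K * (\<Sum>d<n. (real d + 1) * (real d + 2) * cmod z ^ d)"
      by (simp add: sum_distrib_left)
    also have "\<dots> \<le> K * (2 / (1 - cmod z) ^ 3)"
      using that by (intro mult_left_mono quadratic_geometric_sum_le K0) auto
    finally show ?thesis .
  qed
  have sm: "summable (\<lambda>d. cmod (c d * z ^ d))" if "z \<in> disk" for z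
    by (rule summableI_nonneg_bounded[OF _ le[OF that]]) auto
  have fs: "(\<lambda>d. c d * z ^ d) sums f z" if "z \<in> disk" for z
    unfolding f_def by (rule summable_sums[OF summable_norm_cancel[OF sm[OF that]]])
  have hol: "f holomorphic_on disk"
    by (rule power_series_holomorphic[where a=c]) (use fs in auto)
  have Sb: "cmod (S n z) \<le> K * (2 / (1 - cmod z) ^ 3)" if "z \<in> disk" for n z
    unfolding S_def by (rule order_trans[OF norm_sum le[OF that]])
  have fb: "cmod (f z) \<le> K * (2 / (1 - cmod z) ^ 3)" if "z \<in> disk" for z
    by (rule LIMSEQ_le_const2[OF tendsto_norm[OF fs[OF that, unfolded sums_def]]])
       (use Sb[OF that] in \<open>auto simp: S_def\<close>)
  \<comment> \<open>Since 1 - r^2 = (1 - r) (1 + r), three of the four weights cancel the pole and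
    leave (1 + r)^3 <= 8, whence 16 K. The fourth is the weight inside the moments and is only
    estimated by 1 here.\<close>
  have wb: "cmod (wgt z ^ 4 * w) \<le> 16 * K" if "z \<in> disk" "cmod w \<le> K * (2 / (1 - cmod z) ^ 3)" for z w
  proof -
    define r where "r = cmod z"
    have r: "0 \<le> r" "r < 1"
      using that(1) by (auto simp: r_def)
    have w: "cmod (wgt z) = (1 - r) * (1 + r)"
      using wgt_norm(1)[OF that(1)] by (simp add: r_def power2_eq_square algebra_simps)
    have "cmod (wgt z ^ 4 * w) = cmod (wgt z) * (cmod (wgt z) ^ 3 * cmod w)"
      by (simp add: norm_mult norm_power power_numeral_reduce)
    also have "\<dots> \<le> 1 * (cmod (wgt z) ^ 3 * (K * (2 / (1 - r) ^ 3)))"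
      using that wgt_norm(3)[OF that(1)] by (intro mult_mono mult_nonneg_nonneg) (auto simp: r_def)
    also have "\<dots> = 2 * K * (1 + r) ^ 3"
      using r unfolding w power_mult_distrib by simp
    also have "\<dots> \<le> 2 * K * 2 ^ 3"
      using r K0 by (intro mult_left_mono power_mono) auto
    finally show ?thesis by simp
  qed
  have mS: "S n \<in> borel_measurable diskM" for n
    unfolding S_def by (intro measurable_diskM_continuous continuous_intros)
  have mf: "f \<in> borel_measurable diskM"
    by (intro measurable_diskM_continuous holomorphic_on_imp_continuous_on hol)
  have w4: "zpoly (\<lambda>z. wgt z ^ k)" for k
    by (intro zpoly_power zpoly_wgt)
  have m4: "(\<lambda>z. wgt z ^ k) \<in> borel_measurable diskM" for k
    by (intro measurable_diskM_continuous continuous_on_zpoly w4)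
  have mmon: "(\<lambda>z. z ^ j * cnj z ^ k) \<in> borel_measurable diskM" for j k
    by (intro measurable_diskM_continuous continuous_on_zpoly zpoly_mon)
  define H where "H z = wgt z ^ 4 * F z - wgt z ^ 4 * f z" for z
  have L1: "(\<lambda>z. wgt z ^ 4 * F z) \<in> L2_disk"
    using L2_disk_mult_continuous[OF FL continuous_on_zpoly[OF w4, of _ 4]] by (simp add: mult.commute)
  have L2: "(\<lambda>z. wgt z ^ 4 * f z) \<in> L2_disk"
    by (rule L2_diskI_bounded[OF _ wb]) (use m4 mf fb in auto)
  have HL: "H \<in> L2_disk"
    unfolding H_def by (rule L2_disk_diff[OF L1 L2])
  have "(LINT z|diskM. H z * (z ^ j * cnj z ^ k)) = 0" for j k
  proof -
    \<comment> \<open>Three weights go into the test polynomial, so that \<open>cp\<close> applies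
      with the one that remains.\<close>
    define p where "p z = wgt z ^ 3 * (z ^ j * cnj z ^ k)" for z
    have p: "zpoly p"
      unfolding p_def by (intro zpoly_mult w4 zpoly_mon)
    have mon1: "cmod (z ^ j * cnj z ^ k) \<le> 1" if "z \<in> disk" for z
    proof -
      have "cmod z ^ j * cmod z ^ k \<le> 1 * 1"
        using that by (intro mult_mono power_le_one) auto
      then show ?thesis by (simp add: norm_mult norm_power)
    qed
    have "(\<lambda>n. LINT z|diskM. wgt z ^ 4 * S n z * (z ^ j * cnj z ^ k)) \<longlonglongrightarrow>
        (LINT z|diskM. wgt z ^ 4 * f z * (z ^ j * cnj z ^ k))"
    proof (rule integral_dominated_convergence)
      show "integrable diskM (\<lambda>z. 16 * K)"
        by (rule diskM_integrable_const)
      show "AE z in diskM. (\<lambda>n. wgt z ^ 4 * S n z * (z ^ j * cnj z ^ k)) \<longlonglongrightarrow>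
          wgt z ^ 4 * f z * (z ^ j * cnj z ^ k)"
        unfolding S_def by (intro AE_I2 tendsto_intros) (use fs in \<open>auto simp: sums_def\<close>)
      show "AE z in diskM. norm (wgt z ^ 4 * S n z * (z ^ j * cnj z ^ k)) \<le> 16 * K" for n
      proof (rule AE_I2)
        fix z assume "z \<in> space diskM"
        then have z: "z \<in> disk" by simp
        have "cmod (wgt z ^ 4 * S n z) * cmod (z ^ j * cnj z ^ k) \<le> 16 * K * 1"
          using K0 by (intro mult_mono wb Sb mon1 z) auto
        then show "norm (wgt z ^ 4 * S n z * (z ^ j * cnj z ^ k)) \<le> 16 * K"
          by (simp add: norm_mult)
      qed
    qed (use m4 mS mf mmon in measurable)
    moreover have "(LINT z|diskM. wgt z ^ 4 * S n z * (z ^ j * cnj z ^ k)) =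
        (\<Sum>d<n. c d * (LINT z|diskM. wgt z * z ^ d * p z))" for n
    proof -
      have "wgt z ^ 4 * S n z * (z ^ j * cnj z ^ k) = (\<Sum>d<n. c d * (wgt z * z ^ d * p z))" for z
        unfolding S_def p_def sum_distrib_left sum_distrib_right
        by (intro sum.cong) (auto simp: power_numeral_reduce mult_ac)
      then show ?thesis
        using w1[OF p] by (simp add: Bochner_Integration.integral_sum)
    qed
    ultimately have "(\<lambda>d. c d * (LINT z|diskM. wgt z * z ^ d * p z)) sums
        (LINT z|diskM. wgt z ^ 4 * f z * (z ^ j * cnj z ^ k))"
      by (simp add: sums_def)
    from sums_unique2[OF this cp[OF p]]
    have "(LINT z|diskM. wgt z ^ 4 * f z * (z ^ j * cnj z ^ k)) =
        (LINT z|diskM. wgt z ^ 4 * F z * (z ^ j * cnj z ^ k))"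
      by (simp add: p_def power_numeral_reduce mult_ac)
    moreover have "(LINT z|diskM. H z * (z ^ j * cnj z ^ k)) =
        (LINT z|diskM. wgt z ^ 4 * F z * (z ^ j * cnj z ^ k)) - (LINT z|diskM. wgt z ^ 4 * f z * (z ^ j * cnj z ^ k))"
      unfolding H_def left_diff_distrib
      by (intro Bochner_Integration.integral_diff integrable_mult_zpoly[OF L1 zpoly_mon]
          integrable_mult_zpoly[OF L2 zpoly_mon])
    ultimately show ?thesis
      by simp
  qed
  then have "AE z in diskM. H z = 0"
    by (rule AE_eq_0_if_moments_eq_0[OF HL])
  then have "AE z in diskM. F z = f z"
  proof (rule AE_mp, intro AE_I2 impI)
    fix z assume "z \<in> space diskM" "H z = 0"
    moreover from this have "wgt z \<noteq> 0"
      using wgt_norm[of z] by auto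
    ultimately show "F z = f z"
      by (simp add: H_def flip: right_diff_distrib)
  qed
  then show ?thesis
    using hol by blast
qed

section \<open>The null space\<close>

lemma weak_null_iff:
  assumes "F \<in> L2_disk"
  shows "dist_eq (Delta_tilde (dist_of F)) (dist_of (\<lambda>z. 0)) \<longleftrightarrow> weak_null F"
  using assms by (simp add: dist_eq_def weak_null_def Delta_tilde_dist_of dist_of_def)

section \<open>Density of the domain\<close>

lemma integral_by_parts_smooth:
  assumes q: "\<And>k. C_k k q" and \<phi>: "\<phi> \<in> test_functions"
  shows "(LINT z|diskM. q z * wirtinger \<phi> z) = - (LINT z|diskM. wirtinger q z * \<phi> z)"
    and "(LINT z|diskM. q z * wirtinger_bar \<phi> z) = - (LINT z|diskM. wirtinger_bar q z * \<phi> z)"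
proof -
  have c: "continuous_on disk (wirtinger q)" "continuous_on disk (wirtinger_bar q)"
    using C_k_continuous[OF C_k_wirtinger(1)[OF q]] C_k_continuous[OF C_k_wirtinger(2)[OF q]]
    by (auto intro: continuous_on_subset)
  note w = differentiable_has_wirt[OF C_k_differentiable[OF q]]
  show "(LINT z|diskM. q z * wirtinger \<phi> z) = - (LINT z|diskM. wirtinger q z * \<phi> z)"
    and "(LINT z|diskM. q z * wirtinger_bar \<phi> z) = - (LINT z|diskM. wirtinger_bar q z * \<phi> z)"
    by (rule integral_by_parts_disk[OF w c \<phi>])+
qed

lemma L2_disk_smooth: "C_k k q \<Longrightarrow> q \<in> L2_disk"
  using C_k_continuous by (intro L2_disk_continuous) (auto intro: continuous_on_subset)

text \<open>Two integrations by parts move the operator from the test function back to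
  \<open>q\<close>. The resulting function \<open>- 4 * wirtinger u\<close> and
  \<open>wirtinger q\<close> are continuous on the closed disk, hence square-integrable.\<close>

lemma smooth_in_Delta_domain:
  assumes q: "\<And>k. C_k k q"
  shows "q \<in> Delta_domain"
proof -
  have qL: "q \<in> L2_disk"
    by (rule L2_disk_smooth[OF q])
  define u where "u z = (wgt z)\<^sup>2 * wirtinger_bar q z" for z
  have u: "C_k k u" for k
    unfolding u_def[abs_def] by (intro C_k_mult C_k_power C_k_zpoly zpoly_wgt C_k_wirtinger q)
  have "Delta_tilde (dist_of q) \<phi> = dist_of (\<lambda>z. - 4 * wirtinger u z) \<phi>" if \<phi>: "\<phi> \<in> test_functions" for \<phi>
  proof -
    have "(LINT z|diskM. q z * wgt_op \<phi> z) = - (LINT z|diskM. wirtinger_bar q z * ((wgt z)\<^sup>2 * wirtinger \<phi> z))"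
      unfolding wgt_op_def by (rule integral_by_parts_smooth(2)[OF q wgt_sq_wirtinger_test[OF \<phi>]])
    also have "(\<lambda>z. wirtinger_bar q z * ((wgt z)\<^sup>2 * wirtinger \<phi> z)) = (\<lambda>z. u z * wirtinger \<phi> z)"
      by (simp add: u_def mult_ac)
    also have "- (LINT z|diskM. u z * wirtinger \<phi> z) = (LINT z|diskM. wirtinger u z * \<phi> z)"
      unfolding integral_by_parts_smooth(1)[OF u \<phi>] by simp
    finally show ?thesis
      by (simp add: Delta_tilde_dist_of[OF qL \<phi>] dist_of_def mult.assoc)
  qed
  moreover have "(\<lambda>z. - 4 * wirtinger u z) \<in> L2_disk"
    by (intro L2_disk_cmult L2_disk_smooth[OF C_k_wirtinger(1)[OF u]])
  moreover have "wirtinger q \<in> L2_disk"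
    by (rule L2_disk_smooth[OF C_k_wirtinger(1)[OF q]])
  moreover have "dist_dz (dist_of q) \<phi> = dist_of (wirtinger q) \<phi>" if "\<phi> \<in> test_functions" for \<phi>
    by (simp add: dist_dz_def dist_of_def integral_by_parts_smooth(1)[OF q that])
  ultimately show ?thesis
    using qL unfolding Delta_domain_def dist_in_L2_def dist_eq_def by blast
qed

lemma Delta_domain_dense:
  assumes "F \<in> L2_disk" "0 < \<epsilon>"
  shows "\<exists>G\<in>Delta_domain. L2_norm (\<lambda>z. F z - G z) < \<epsilon>"
proof -
  obtain p where p: "zpoly p" "(LINT z|diskM. (cmod (F z - p z))\<^sup>2) < \<epsilon>\<^sup>2"
    using L2_approx_zpoly[OF assms(1), of "\<epsilon>\<^sup>2"] assms(2) by auto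
  have "L2_norm (\<lambda>z. F z - p z) < \<epsilon>"
    unfolding L2_norm_def using p(2) assms(2) by (simp add: real_less_lsqrt)
  then show ?thesis
    using smooth_in_Delta_domain[OF C_k_zpoly[OF p(1)]] by blast
qed

section \<open>Square integrability of functions in the Dirichlet space\<close>

lemma nn_integral_diskM: "(\<integral>\<^sup>+ z. u z \<partial>diskM) = (\<integral>\<^sup>+ z. u z * indicator disk z \<partial>lborel)"
proof -
  have "(\<integral>\<^sup>+ z. u z \<partial>diskM) = (\<integral>\<^sup>+ z. u z * indicator disk z \<partial>lebesgue)"
    by (rule nn_integral_restrict_space) auto
  then show ?thesis
    by (simp add: nn_integral_completion)
qed

lemma L2_disk_iff_nn_integral:
  "f \<in> L2_disk \<longleftrightarrow> f \<in> borel_measurable diskM \<and> (\<integral>\<^sup>+ z. ennreal ((cmod (f z))\<^sup>2) \<partial>diskM) < \<infinity>"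
  by (auto simp: L2_disk_def integrable_iff_bounded)

lemma dirichlet_space_iff:
  "f \<in> dirichlet_space \<longleftrightarrow> f holomorphic_on disk \<and> deriv f \<in> L2_disk"
proof -
  have "deriv f \<in> borel_measurable diskM" if "f holomorphic_on disk"
    using that by (intro measurable_diskM_continuous holomorphic_on_imp_continuous_on holomorphic_deriv) auto
  then show ?thesis
    by (auto simp: dirichlet_space_def L2_disk_iff_nn_integral ennreal_mult_less_top ennreal_mult_eq_top_iff
        less_top top_unique)
qed

lemma nn_integral_scale_complex:
  fixes h :: "complex \<Rightarrow> ennreal"
  assumes "h \<in> borel_measurable borel" "t \<noteq> 0"
  shows "(\<integral>\<^sup>+ z. h z \<partial>lborel) = ennreal (t\<^sup>2) * (\<integral>\<^sup>+ z. h (t *\<^sub>R z) \<partial>lborel)"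
proof -
  have "(\<integral>\<^sup>+ z. h z \<partial>lborel) =
      (\<integral>\<^sup>+ z. h z \<partial>density (distr lborel borel (\<lambda>z. 0 + t *\<^sub>R z)) (\<lambda>_. ennreal (\<bar>t\<bar> ^ DIM(complex))))"
    using lborel_affine[OF assms(2), of "0::complex"] by simp
  also have "\<dots> = (\<integral>\<^sup>+ z. ennreal (t\<^sup>2) * h (t *\<^sub>R z) \<partial>lborel)"
    using assms(1) by (subst nn_integral_density) (auto simp: nn_integral_distr)
  also have "\<dots> = ennreal (t\<^sup>2) * (\<integral>\<^sup>+ z. h (t *\<^sub>R z) \<partial>lborel)"
    by (intro nn_integral_cmult measurable_compose[OF _ assms(1)]) simp
  finally show ?thesis .
qed

text \<open>Integrate (G - 2 c)^2 >= 0, where 2 c is the mean of G over an interval of length 1/2.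
  This is the Cauchy-Schwarz inequality with its constant 1/2 relaxed to 1.\<close>

lemma power2_integral_le:
  fixes G :: "real \<Rightarrow> real"
  assumes "continuous_on {1/2..1} G"
  shows "(integral {1/2..1} G)\<^sup>2 \<le> integral {1/2..1} (\<lambda>t. (G t)\<^sup>2)"
proof -
  define c where "c = integral {1/2..1} G"
  have i: "G integrable_on {1/2..1}" "(\<lambda>t. (G t)\<^sup>2) integrable_on {1/2..1}"
    by (intro integrable_continuous_real continuous_intros assms)+
  have "((\<lambda>t. (G t)\<^sup>2 - (4 * c) * G t + 4 * c\<^sup>2) has_integral
      (integral {1/2..1} (\<lambda>t. (G t)\<^sup>2) - (4 * c) * c + (1 - 1/2) * (4 * c\<^sup>2))) {1/2..1}"
    unfolding c_def
    using has_integral_const_real[of "4 * (integral {1/2..1} G)\<^sup>2" "1/2" 1]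
    by (intro has_integral_add has_integral_diff has_integral_mult_right integrable_integral i) auto
  then have "0 \<le> integral {1/2..1} (\<lambda>t. (G t)\<^sup>2) - (4 * c) * c + (1 - 1/2) * (4 * c\<^sup>2)"
  proof (rule has_integral_nonneg)
    show "0 \<le> (G t)\<^sup>2 - (4 * c) * G t + 4 * c\<^sup>2" for t
      using zero_le_power2[of "G t - 2 * c"] by (simp add: power2_eq_square algebra_simps)
  qed
  also have "\<dots> = integral {1/2..1} (\<lambda>t. (G t)\<^sup>2) - 2 * c\<^sup>2"
    by (simp add: power2_eq_square)
  finally show ?thesis
    unfolding c_def[symmetric] using zero_le_power2[of c] by linarith
qed

text \<open>Comparing with \<open>z / 2\<close> rather than with the origin keeps the scaling factor
  \<open>1 / t\<^sup>2\<close> of the area bounded.\<close>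

lemma holomorphic_increment_bound:
  assumes f: "f holomorphic_on disk" and z: "z \<in> disk"
  shows "ennreal ((cmod (f z - f (z / 2)))\<^sup>2) \<le>
    (\<integral>\<^sup>+ t. indicator {1/2..1} t * ennreal ((cmod (indicator disk (t *\<^sub>R z) *\<^sub>R deriv f (t *\<^sub>R z)))\<^sup>2) \<partial>lborel)"
proof -
  have tz: "t *\<^sub>R z \<in> disk" if "t \<in> {1/2..1}" for t :: real
  proof -
    have "\<bar>t\<bar> * cmod z \<le> 1 * cmod z"
      using that by (intro mult_right_mono) auto
    then show ?thesis
      using z by simp
  qed
  have dc: "continuous_on disk (deriv f)"
    using f by (intro holomorphic_on_imp_continuous_on holomorphic_deriv) auto
  define G where "G t = cmod (deriv f (t *\<^sub>R z))" for t
  have Dc: "continuous_on {1/2..1} (\<lambda>t. deriv f (t *\<^sub>R z))"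
    by (rule continuous_on_compose2[OF dc]) (use tz in \<open>auto intro!: continuous_intros\<close>)
  then have Gc: "continuous_on {1/2..1} G"
    unfolding G_def by (intro continuous_intros)
  have "((\<lambda>t. z * deriv f (t *\<^sub>R z)) has_integral (f (1 *\<^sub>R z) - f ((1/2) *\<^sub>R z))) {1/2..1}"
  proof (rule fundamental_theorem_of_calculus)
    fix t :: real assume t: "t \<in> {1/2..1}"
    have "(f has_field_derivative deriv f (t *\<^sub>R z)) (at (t *\<^sub>R z))"
      using holomorphic_derivI[OF f open_ball tz[OF t]] .
    moreover have "((\<lambda>t. t *\<^sub>R z) has_vector_derivative z) (at t within {1/2..1})"
      by (auto intro!: derivative_eq_intros)
    ultimately show "((\<lambda>t. f (t *\<^sub>R z)) has_vector_derivative z * deriv f (t *\<^sub>R z)) (at t within {1/2..1})"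
      using field_vector_diff_chain_within[of "\<lambda>t. t *\<^sub>R z" z t "{1/2..1}" f "deriv f (t *\<^sub>R z)"]
      by (simp add: o_def has_field_derivative_at_within)
  qed simp
  then have fi: "((\<lambda>t. z * deriv f (t *\<^sub>R z)) has_integral (f z - f (z / 2))) {1/2..1}"
    by (simp add: scaleR_conv_of_real)
  have "cmod (f z - f (z / 2)) \<le> integral {1/2..1} G"
    unfolding integral_unique[OF fi, symmetric]
  proof (rule Henstock_Kurzweil_Integration.integral_norm_bound_integral)
    show "cmod (z * deriv f (t *\<^sub>R z)) \<le> G t" for t
      using z by (simp add: G_def norm_mult mult_left_le_one_le)
  qed (use fi Gc in \<open>auto intro: integrable_continuous_real\<close>)
  then have "(cmod (f z - f (z / 2)))\<^sup>2 \<le> (integral {1/2..1} G)\<^sup>2"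
    by (intro power_mono) auto
  also have "\<dots> \<le> integral {1/2..1} (\<lambda>t. (G t)\<^sup>2)"
    by (rule power2_integral_le[OF Gc])
  finally have *: "ennreal ((cmod (f z - f (z / 2)))\<^sup>2) \<le> ennreal (integral {1/2..1} (\<lambda>t. (G t)\<^sup>2))"
    by (rule ennreal_leI)
  have "((\<lambda>t. (G t)\<^sup>2) has_integral integral {1/2..1} (\<lambda>t. (G t)\<^sup>2)) {1/2..1}"
    by (intro integrable_integral integrable_continuous_real continuous_intros Gc)
  moreover have "(\<lambda>t. indicator {1/2..1} t *\<^sub>R (G t)\<^sup>2) = (\<lambda>t. if t \<in> {1/2..1} then (G t)\<^sup>2 else 0)"
    by (auto simp: indicator_def fun_eq_iff)
  ultimately have "((\<lambda>t. indicator {1/2..1} t *\<^sub>R (G t)\<^sup>2) has_integral integral {1/2..1} (\<lambda>t. (G t)\<^sup>2)) UNIV"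
    by (simp only: has_integral_restrict_UNIV)
  moreover have "(\<lambda>t. indicator {1/2..1} t *\<^sub>R (G t)\<^sup>2) \<in> borel_measurable borel"
    by (intro borel_measurable_continuous_on_indicator continuous_intros Gc) auto
  ultimately have "(\<integral>\<^sup>+ t. ennreal (indicator {1/2..1} t *\<^sub>R (G t)\<^sup>2) \<partial>lborel) =
      ennreal (integral {1/2..1} (\<lambda>t. (G t)\<^sup>2))"
    by (intro nn_integral_has_integral_lborel) auto
  also have "(\<integral>\<^sup>+ t. ennreal (indicator {1/2..1} t *\<^sub>R (G t)\<^sup>2) \<partial>lborel) =
      (\<integral>\<^sup>+ t. indicator {1/2..1} t * ennreal ((cmod (indicator disk (t *\<^sub>R z) *\<^sub>R deriv f (t *\<^sub>R z)))\<^sup>2) \<partial>lborel)"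
    using tz by (intro nn_integral_cong) (auto simp: G_def indicator_def)
  finally show ?thesis
    using * by simp
qed

text \<open>Integrate the increment bound over the disk, exchange the integrals and substitute w = t
  z, which costs 1 / t^2 <= 4. The remaining function z -> f (z / 2) is bounded, as it sees
  \<open>f\<close> only on the closed disk of radius 1/2. The result is what gives \<open>f\<close>
  a class at all: \<open>L2_class\<close> is empty outside \<open>L2_disk\<close>.\<close>

lemma dirichlet_space_L2:
  assumes f: "f holomorphic_on disk" and d: "deriv f \<in> L2_disk"
  shows "f \<in> L2_disk"
proof -
  have dc: "continuous_on disk (deriv f)"
    using f by (intro holomorphic_on_imp_continuous_on holomorphic_deriv) auto
  define h where "h z = ennreal ((cmod (indicator disk z *\<^sub>R deriv f z))\<^sup>2)" for z
  have "(\<lambda>z. indicator disk z *\<^sub>R deriv f z) \<in> borel_measurable borel"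
    by (rule borel_measurable_continuous_on_indicator[OF _ dc]) auto
  then have hm: "h \<in> borel_measurable borel"
    unfolding h_def by measurable
  have "(\<integral>\<^sup>+ z. h z \<partial>lborel) = (\<integral>\<^sup>+ z. ennreal ((cmod (deriv f z))\<^sup>2) \<partial>diskM)"
    unfolding nn_integral_diskM h_def by (intro nn_integral_cong) (auto simp: indicator_def)
  then have I: "(\<integral>\<^sup>+ z. h z \<partial>lborel) < \<infinity>"
    using d by (simp add: L2_disk_iff_nn_integral)
  have pm: "(\<lambda>(t, z). indicator {1/2..1} t * h (t *\<^sub>R z)) \<in> borel_measurable (lborel \<Otimes>\<^sub>M lborel)"
    unfolding case_prod_beta
    by (intro borel_measurable_times_ennreal measurable_compose[OF _ hm]) measurable
  have "(\<integral>\<^sup>+ z. ennreal ((cmod (f z - f (z / 2)))\<^sup>2) \<partial>diskM) \<le>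
      (\<integral>\<^sup>+ z. (\<integral>\<^sup>+ t. indicator {1/2..1} t * h (t *\<^sub>R z) \<partial>lborel) \<partial>lborel)"
    unfolding nn_integral_diskM h_def
    using holomorphic_increment_bound[OF f] by (intro nn_integral_mono) (auto simp: indicator_def)
  also have "\<dots> = (\<integral>\<^sup>+ t. (\<integral>\<^sup>+ z. indicator {1/2..1} t * h (t *\<^sub>R z) \<partial>lborel) \<partial>lborel)"
    using lborel_pair.Fubini[OF pm] by simp
  also have "\<dots> \<le> (\<integral>\<^sup>+ t. indicator {1/2..1::real} t * (4 * (\<integral>\<^sup>+ z. h z \<partial>lborel)) \<partial>lborel)"
  proof (rule nn_integral_mono)
    fix t :: real
    show "(\<integral>\<^sup>+ z. indicator {1/2..1} t * h (t *\<^sub>R z) \<partial>lborel) \<le>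
        indicator {1/2..1} t * (4 * (\<integral>\<^sup>+ z. h z \<partial>lborel))"
    proof (cases "t \<in> {1/2..1}")
      case True
      then have "(1/2)\<^sup>2 \<le> t\<^sup>2"
        by (intro power_mono) auto
      then have "(1::ennreal) \<le> 4 * ennreal (t\<^sup>2)"
        by (simp add: ennreal_mult[symmetric] ennreal_numeral[symmetric] power2_eq_square flip: ennreal_1 del: ennreal_numeral)
      then have "1 * (\<integral>\<^sup>+ z. h (t *\<^sub>R z) \<partial>lborel) \<le> 4 * ennreal (t\<^sup>2) * (\<integral>\<^sup>+ z. h (t *\<^sub>R z) \<partial>lborel)"
        by (intro mult_right_mono) auto
      then show ?thesis
        using True nn_integral_scale_complex[OF hm, of t] by (simp add: mult.assoc)
    qed simp
  qed
  also have "\<dots> = 4 * (\<integral>\<^sup>+ z. h z \<partial>lborel) * ennreal (1 - 1/2)"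
    by (subst mult.commute, subst nn_integral_cmult) auto
  also have "\<dots> < \<infinity>"
    using I ennreal_less_top[of "1 - 1/2"] ennreal_less_top[of 4]
    by (auto simp: ennreal_mult_less_top)
  finally have fin: "(\<integral>\<^sup>+ z. ennreal ((cmod (f z - f (z / 2)))\<^sup>2) \<partial>diskM) < \<infinity>" .
  have fc: "continuous_on disk f"
    by (rule holomorphic_on_imp_continuous_on[OF f])
  have hc: "continuous_on (cball 0 1) (\<lambda>z. f (z / 2))"
    by (rule continuous_on_compose2[OF fc]) (auto intro!: continuous_intros simp: norm_divide)
  have "(\<lambda>z. f z - f (z / 2)) \<in> L2_disk"
    unfolding L2_disk_iff_nn_integral using fin continuous_on_subset[OF hc, of disk]
    by (auto intro!: measurable_diskM_continuous continuous_on_diff fc)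
  from L2_disk_add[OF this L2_disk_continuous[OF hc]] show ?thesis
    by simp
qed

section \<open>Comparison of functions that define the same distribution\<close>

lemma L2_disk_mult_test:
  assumes w: "continuous_on disk w" and \<phi>: "\<phi> \<in> test_functions"
  shows "(\<lambda>z. w z * \<phi> z) \<in> L2_disk"
proof -
  obtain r where r: "0 < r" "r < 1" "\<And>z. r < cmod z \<Longrightarrow> \<phi> z = 0"
    using test_functionsE[OF \<phi>] by blast
  have \<phi>c: "continuous_on disk \<phi>"
    using C_k_continuous[OF test_functions_C_k[OF \<phi>]] continuous_on_subset by blast
  have c: "continuous_on disk (\<lambda>z. w z * \<phi> z)"
    by (intro continuous_intros w \<phi>c)
  have "continuous_on UNIV (\<lambda>z. if z \<in> disk then w z * \<phi> z else 0)"
    by (rule continuous_on_extend_zero[OF c r(2)]) (simp add: r(3))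
  then have "(\<lambda>z. if z \<in> disk then w z * \<phi> z else 0) \<in> L2_disk"
    by (intro L2_disk_continuous) (auto intro: continuous_on_subset)
  then have "integrable diskM (\<lambda>z. (cmod (if z \<in> disk then w z * \<phi> z else 0))\<^sup>2)"
    by (rule L2_diskD(2))
  then have "integrable diskM (\<lambda>z. (cmod (w z * \<phi> z))\<^sup>2)"
    by (rule Bochner_Integration.integrable_cong[THEN iffD1, rotated 2]) auto
  then show ?thesis
    using measurable_diskM_continuous[OF c] by (simp add: L2_disk_def)
qed

text \<open>Since \<open>w\<close> is only continuous in the open disk, the moment criterion is
  applied to the difference times a cutoff: a polynomial times a cutoff is a test function. Each
  point of the disk lies where some cutoff of the sequence is nonzero, and countably many
  exceptional null sets do no harm.\<close>

lemma AE_eq_if_dist_eq: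
  assumes w: "continuous_on disk w" and G: "G \<in> L2_disk"
    and eq: "\<And>\<phi>. \<phi> \<in> test_functions \<Longrightarrow> (LINT z|diskM. w z * \<phi> z) = (LINT z|diskM. G z * \<phi> z)"
  shows "AE z in diskM. w z = G z"
proof -
  define e where "e n = 1 / (real n + 2)" for n
  have e: "0 < e n" "e n < 1" for n
    by (auto simp: e_def)
  have e0: "e \<longlonglongrightarrow> 0"
    unfolding e_def by real_asymp
  have t1: "(\<lambda>z. cutoff (e n) 1 z * q z) \<in> test_functions" if "zpoly q" for n q
    by (rule cutoff_test_function[OF e C_k_zpoly[OF that]])
  have t0: "cutoff (e n) 1 \<in> test_functions" for n
    using t1[OF zpoly_const[of 1], of n] by simp
  have i: "integrable diskM (\<lambda>z. w z * \<phi> z)" "integrable diskM (\<lambda>z. G z * \<phi> z)" if "\<phi> \<in> test_functions" for \<phi>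
    using L2_diskD(3)[OF L2_disk_mult_test[OF w that]] integrable_L2_test[OF G that] by auto
  have "AE z in diskM. w z * cutoff (e n) 1 z - G z * cutoff (e n) 1 z = 0" for n
  proof (rule AE_eq_0_if_moments_eq_0)
    show "(\<lambda>z. w z * cutoff (e n) 1 z - G z * cutoff (e n) 1 z) \<in> L2_disk"
      using C_k_continuous[OF test_functions_C_k[OF t0]]
      by (intro L2_disk_diff L2_disk_mult_test w t0 L2_disk_mult_continuous G) (auto intro: continuous_on_subset)
    fix j k
    define \<phi> where "\<phi> = (\<lambda>z. cutoff (e n) 1 z * (z ^ j * cnj z ^ k))"
    have \<phi>: "\<phi> \<in> test_functions"
      unfolding \<phi>_def by (rule t1[OF zpoly_mon])
    have "(LINT z|diskM. (w z * cutoff (e n) 1 z - G z * cutoff (e n) 1 z) * (z ^ j * cnj z ^ k)) =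
        (LINT z|diskM. w z * \<phi> z - G z * \<phi> z)"
      by (simp add: \<phi>_def algebra_simps)
    also have "\<dots> = 0"
      using i[OF \<phi>] eq[OF \<phi>] by simp
    finally show "(LINT z|diskM. (w z * cutoff (e n) 1 z - G z * cutoff (e n) 1 z) * (z ^ j * cnj z ^ k)) = 0" .
  qed
  then have "AE z in diskM. \<forall>n. w z * cutoff (e n) 1 z - G z * cutoff (e n) 1 z = 0"
    unfolding AE_all_countable by (rule allI)
  then show ?thesis
  proof (rule AE_mp, intro AE_I2 impI)
    fix z assume z: "z \<in> space diskM" and all: "\<forall>n. w z * cutoff (e n) 1 z - G z * cutoff (e n) 1 z = 0"
    have "(cmod z)\<^sup>2 < 1"
      using z by (simp add: abs_square_less_1)
    then have "\<forall>\<^sub>F n in sequentially. e n < 1 - (cmod z)\<^sup>2"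
      by (intro order_tendstoD[OF e0]) auto
    then obtain n where "e n < 1 - (cmod z)\<^sup>2"
      by (meson eventually_happens' sequentially_bot)
    then have "cutoff (e n) 1 z \<noteq> 0"
      using e(1)[of n] by (simp add: cutoff_def flat_exp_def)
    then show "w z = G z"
      using all by (auto simp flip: left_diff_distrib)
  qed
qed

lemma L2_disk_cong_AE:
  assumes "F \<in> L2_disk" "f \<in> borel_measurable diskM" "AE z in diskM. F z = f z"
  shows "f \<in> L2_disk"
proof -
  have "(\<integral>\<^sup>+ z. ennreal ((cmod (f z))\<^sup>2) \<partial>diskM) = (\<integral>\<^sup>+ z. ennreal ((cmod (F z))\<^sup>2) \<partial>diskM)"
    using assms(3) by (intro nn_integral_cong_AE) (auto elim!: AE_mp)
  then show ?thesis
    using assms(1,2) by (simp add: L2_disk_iff_nn_integral)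
qed

lemma L2_class_cong:
  assumes "F \<in> L2_disk" "f \<in> L2_disk" "AE z in diskM. F z = f z"
  shows "L2_class F = L2_class f"
proof -
  have "(AE z in diskM. F z = G z) \<longleftrightarrow> (AE z in diskM. f z = G z)" for G
    using assms(3) by (intro iffI; elim AE_mp) (auto elim!: AE_mp intro!: AE_I2)
  then show ?thesis
    using assms(1,2) by (simp add: L2_class_def)
qed

lemma dirichlet_space_null:
  assumes "f \<in> dirichlet_space"
  shows "f \<in> Delta_domain" "weak_null f"
proof -
  have f: "f holomorphic_on disk" and d: "deriv f \<in> L2_disk"
    using assms by (auto simp: dirichlet_space_iff)
  have L: "f \<in> L2_disk"
    by (rule dirichlet_space_L2[OF f d])
  show w: "weak_null f"
    by (rule weak_null_holomorphic[OF f L])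
  have "dist_eq (Delta_tilde (dist_of f)) (dist_of (\<lambda>z. 0))"
    using weak_null_iff[OF L] w by simp
  moreover have "dist_eq (dist_dz (dist_of f)) (dist_of (deriv f))"
    by (simp add: dist_eq_def dist_dz_def dist_of_def integral_holomorphic_wirtinger_bar(2)[OF f])
  ultimately show "f \<in> Delta_domain"
    using L d L2_disk_zpoly[OF zpoly.zero] unfolding Delta_domain_def dist_in_L2_def by blast
qed

text \<open>The distributional z-derivative sees only the class of \<open>F\<close>, so it is given
  by \<open>deriv f\<close>. By the domain condition it is also given by some \<open>G\<close> in
  \<open>L2_disk\<close>, and therefore \<open>deriv f\<close> agrees with \<open>G\<close> almost
  everywhere.\<close>

lemma weak_null_dirichlet_representative:
  assumes F: "F \<in> Delta_domain" and w: "weak_null F"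
  shows "\<exists>f\<in>dirichlet_space. L2_class F = L2_class f"
proof -
  obtain f where f: "f holomorphic_on disk" and ae: "AE z in diskM. F z = f z"
    using weak_null_imp_holomorphic[OF w] by blast
  note FL = weak_null_L2[OF w]
  have dc: "continuous_on disk (deriv f)"
    using f by (intro holomorphic_on_imp_continuous_on holomorphic_deriv) auto
  have fm: "f \<in> borel_measurable diskM"
    by (intro measurable_diskM_continuous holomorphic_on_imp_continuous_on f)
  have fL: "f \<in> L2_disk"
    by (rule L2_disk_cong_AE[OF FL fm ae])
  obtain G where G: "G \<in> L2_disk" "\<And>\<phi>. \<phi> \<in> test_functions \<Longrightarrow> dist_dz (dist_of F) \<phi> = dist_of G \<phi>"
    using F unfolding Delta_domain_def dist_in_L2_def dist_eq_def by blast
  have "AE z in diskM. deriv f z = G z"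
  proof (rule AE_eq_if_dist_eq[OF dc G(1)])
    fix \<phi> assume \<phi>: "\<phi> \<in> test_functions"
    note t = test_functions_wirtinger(1)[OF \<phi>]
    have "(LINT z|diskM. F z * wirtinger \<phi> z) = (LINT z|diskM. f z * wirtinger \<phi> z)"
    proof (rule integral_cong_AE)
      show "AE z in diskM. F z * wirtinger \<phi> z = f z * wirtinger \<phi> z"
        using ae by eventually_elim simp
    qed (use integrable_L2_test[OF FL t] integrable_L2_test[OF fL t] in auto)
    then show "(LINT z|diskM. deriv f z * \<phi> z) = (LINT z|diskM. G z * \<phi> z)"
      using G(2)[OF \<phi>] integral_holomorphic_wirtinger_bar(2)[OF f \<phi>]
      by (simp add: dist_dz_def dist_of_def)
  qed
  then have "AE z in diskM. G z = deriv f z"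
    by eventually_elim simp
  then have "deriv f \<in> L2_disk"
    by (rule L2_disk_cong_AE[OF G(1) measurable_diskM_continuous[OF dc]])
  then show ?thesis
    using f L2_class_cong[OF FL fL ae] by (auto simp: dirichlet_space_iff)
qed

text \<open>The equation compares sets of classes, because a null solution becomes holomorphic only
  after a change on a null set. The first conjunct records that the operator is densely
  defined.\<close>

theorem proposition3p1:
  "(\<forall>F\<in>L2_disk. \<forall>\<epsilon>>0. \<exists>G\<in>Delta_domain. L2_norm (\<lambda>z. F z - G z) < \<epsilon>) \<and>
   L2_class ` dirichlet_space =
     L2_class ` {F \<in> Delta_domain. dist_eq (Delta_tilde (dist_of F)) (dist_of (\<lambda>z. 0))}"
proof -
  have "{F \<in> Delta_domain. dist_eq (Delta_tilde (dist_of F)) (dist_of (\<lambda>z. 0))} =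
      {F \<in> Delta_domain. weak_null F}"
    using weak_null_iff by (auto simp: Delta_domain_def)
  then show ?thesis
    using Delta_domain_dense dirichlet_space_null weak_null_dirichlet_representative
    by (auto simp: image_iff)
qed

end
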